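(* Let $0<p<\tilde p\le 1/2$ and let $1=t_0<t_1<\dots<t_n<\cdots$ be integers with $\lim_{n\to\infty} t_n/t_{n+1}=0$. Let $\mathbb X=\{0,1\}^{\mathbb N^*}$ (with $\mathbb N^*=\{1,2,\dots\}$) be endowed with the ultrametric which assigns diameter $2^{-n}$ to cylinders of order $n$, and let $\mu$ be the probability measure on $\mathbb X$ which assigns to each cylinder the mass $\mu([\varepsilon_1\varepsilon_2\dots\varepsilon_n])=\prod_{j=1}^n\varpi_j$, where - if $t_{2k-1}\le j<t_{2k}$ for some $k$, then $\varpi_j=p$ if $\varepsilon_j=0$ and $\varpi_j=1-p$ otherwise; - if $t_{2k}\le j<t_{2k+1}$ for some $k$, then $\varpi_j=\tilde p$ if $\varepsilon_j=0$ and $\varpi_j=1-\tilde p$ otherwise. Let $b(q)=b_{\mu,\mathrm S_\mu}(q)$ and $B(q)=B_{\mu,\mathrm S_\mu}(q)$, $q\in\mathbb R$, be the Hausdorff and packing multifractal functions of $\mu$ (defined in the context; here $\mathrm S_\mu=\mathbb X$), let $B'_l,B'_r$ be the left and right derivatives of the convex function $B$, and let $$X_\mu(\alpha)=\Bigl\{x\in\mathbb X\ ;\ \lim_{r\searrow0}\frac{\log\mu(\mathsf B(x,r))}{\log r}=\alpha\Bigr\}.$$ Then: 1. For every $\alpha\in\bigl(-\log_2(1-\tilde p),-\log_2\tilde p\bigr)$, $$\dim_H X_\mu(\alpha)=\inf_{q\in\mathbb R}\bigl(b(q)+\alpha q\bigr).$$ 2. For every $\alpha\in\bigl(-\log_2(1-\tilde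 p),-\log_2\tilde p\bigr)\setminus\bigl([-B'_r(0),-B'_l(0)]\cup[-B'_r(1),-B'_l(1)]\bigr)$, $$\dim_P X_\mu(\alpha)=\inf_{q\in\mathbb R}\bigl(B(q)+\alpha q\bigr).$$
   Context: $\dim_H$ and $\dim_P$ are the Hausdorff and (Tricot) packing dimensions. $\mathsf B(x,r)$ is the open ball; in a collection of balls $\{\mathsf B_j\}$, $\mathsf B_j=\mathsf B(x_j,r_j)$. A $\delta$-packing of $E$ is a collection of pairwise disjoint balls centered in $E$ with radii $\le\delta$; a centered $\delta$-cover of $E$ is a collection of balls with centers in $E$ and radii $\le\delta$ whose union contains $E$. The support $\mathrm S_\mu$ is the complement of the union of all balls of $\mu$-measure $0$. For $q,t\in\mathbb R$, $\delta>0$ and $E\subset\mathbb X$ (where $\sum^*$ means summing only the terms with $\mu(\mathsf B_j)\ne0$): $$\overline{\mathscr P}^{q,t}_{\mu,\delta}(E)=\sup\Bigl\{\sum\nolimits^{*} r_j^t\mu(\mathsf B_j)^q;\ \{\mathsf B_j\}\ \delta\text{-packing of }E\Bigr\},\quad \overline{\mathscr P}^{q,t}_{\mu}(E)=\lim_{\delta\searrow0}\overline{\mathscr P}^{q,t}_{\mu,\delta}(E),$$ $$\mathscr P^{q,t}_\mu(E)=\inf\Bigl\{\sum_j\overline{\mathscr P}^{q,t}_\mu(E_j);\ E\subset\bigcup_j E_j\Bigr\}\ \text{(countable covers)},$$ $$\overline{\mathscr H}^{q,t}_{\mu,\delta}(E)=\inf\Bigl\{\sum\nolimits^{*} r_j^t\mu(\mathsf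 B_j)^q;\ \{\mathsf B_j\}\ \text{centered }\delta\text{-cover of }E\Bigr\},\quad \overline{\mathscr H}^{q,t}_{\mu}(E)=\lim_{\delta\searrow0}\overline{\mathscr H}^{q,t}_{\mu,\delta}(E),$$ $$\mathscr H^{q,t}_\mu(E)=\sup\{\overline{\mathscr H}^{q,t}_\mu(F);\ F\subset E\}.$$ Then $B_{\mu,E}(q)=\inf\{t\in\mathbb R;\ \mathscr P^{q,t}_\mu(E)=0\}$ and $b_{\mu,E}(q)=\inf\{t\in\mathbb R;\ \mathscr H^{q,t}_\mu(E)=0\}$. *)

theory Defs
  imports "HOL-Probability.Probability"
begin

section \<open>The sequence space\<close>

typedef cantor = "{1::nat..} \<rightarrow>\<^sub>E (UNIV :: bool set)"
  morphisms coord Abs_cantor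
  by (simp add: PiE_eq_empty_iff ex_in_conv)

lemma coord_eqI:
  assumes "\<And>j. j \<ge> 1 \<Longrightarrow> coord x j = coord y j"
  shows "x = y"
proof -
  have "coord x = coord y"
    by (rule PiE_ext[OF coord coord]) (use assms in auto)
  then show ?thesis by (simp add: coord_inject)
qed

text \<open>The distance of two distinct sequences is \<open>2\<^sup>-\<^sup>n\<close>, where \<open>n\<close> is the number of their
  common leading terms; \<open>diameter_cylinder\<close> below shows that this is the normalisation under
  which cylinders of order \<open>n\<close> have diameter \<open>2\<^sup>-\<^sup>n\<close>.\<close>

instantiation cantor :: metric_space
begin

definition dist_cantor :: "cantor \<Rightarrow> cantor \<Rightarrow> real" where
  "dist_cantor x y =
     (if x = y then 0 else (1/2) ^ (LEAST n. coord x (Suc n) \<noteq> coord y (Suc n)))"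

definition uniformity_cantor :: "(cantor \<times> cantor) filter" where
  "uniformity_cantor = (INF e\<in>{0 <..}. principal {(x, y). dist x y < e})"

definition open_cantor :: "cantor set \<Rightarrow> bool" where
  "open_cantor U = (\<forall>x\<in>U. eventually (\<lambda>(x', y). x' = x \<longrightarrow> y \<in> U) uniformity)"

lemma dist_cantor_le_iff:
  "dist x y \<le> (1/2) ^ n \<longleftrightarrow> (\<forall>j\<in>{1..n}. coord x j = coord y j)" for x y :: cantor
proof (cases "x = y")
  case True
  then show ?thesis by (simp add: dist_cantor_def)
next
  case False
  define k where "k = (LEAST n. coord x (Suc n) \<noteq> coord y (Suc n))"
  have "\<exists>m. coord x (Suc m) \<noteq> coord y (Suc m)"
    proof (rule ccontr)
    assume "\<nexists>m. coord x (Suc m) \<noteq> coord y (Suc m)"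
    then have "x = y"
      by (intro coord_eqI) (metis One_nat_def Suc_le_D)
    with False show False ..
  qed
  then have k: "coord x (Suc k) \<noteq> coord y (Suc k)"
    unfolding k_def by (rule LeastI_ex)
  have less: "coord x (Suc m) = coord y (Suc m)" if "m < k" for m
    using not_less_Least[of m "\<lambda>n. coord x (Suc n) \<noteq> coord y (Suc n)"] that
    unfolding k_def by blast
  have "dist x y \<le> (1/2) ^ n \<longleftrightarrow> n \<le> k"
    using False unfolding dist_cantor_def k_def[symmetric] by (simp add: power_decreasing_iff)
  also have "\<dots> \<longleftrightarrow> (\<forall>j\<in>{1..n}. coord x j = coord y j)"
  proof
    assume "n \<le> k"
    show "\<forall>j\<in>{1..n}. coord x j = coord y j"
    proof
      fix j assume j: "j \<in> {1..n}"
      then obtain m where "j = Suc m" by (cases j) auto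
      then show "coord x j = coord y j" using less[of m] j \<open>n \<le> k\<close> by auto
    qed
  next
    assume "\<forall>j\<in>{1..n}. coord x j = coord y j"
    then have "Suc k \<notin> {1..n}" using k by blast
    then show "n \<le> k" by simp
  qed
  finally show ?thesis .
qed

lemma dist_cantor_ultrametric: "dist x y \<le> max (dist x z) (dist y z)" for x y z :: cantor
proof (cases "x = z \<or> y = z")
  case True
  moreover have "dist y x = dist x y"
    unfolding dist_cantor_def by (simp add: eq_commute)
  moreover have "dist x y \<ge> 0"
    by (simp add: dist_cantor_def)
  ultimately show ?thesis by auto
next
  case False
  then obtain m n where mn: "dist x z = (1/2) ^ m" "dist y z = (1/2) ^ n"
    by (auto simp: dist_cantor_def)
  have "dist x z \<le> (1/2) ^ min m n" "dist y z \<le> (1/2) ^ min m n"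
    unfolding mn by (simp_all add: power_decreasing)
  then have "dist x y \<le> (1/2) ^ min m n"
    unfolding dist_cantor_le_iff by auto
  also have "\<dots> = max (dist x z) (dist y z)"
    unfolding mn by (auto simp: min_def max_def power_decreasing_iff)
  finally show ?thesis .
qed

instance
proof
  fix x y z :: cantor
  show "dist x y = 0 \<longleftrightarrow> x = y"
    by (simp add: dist_cantor_def)
  have "dist x z \<ge> 0" "dist y z \<ge> 0"
    by (simp_all add: dist_cantor_def)
  then show "dist x y \<le> dist x z + dist y z"
    using dist_cantor_ultrametric[of x y z] by linarith
qed (simp_all add: uniformity_cantor_def open_cantor_def)

end

definition cylinder :: "(nat \<Rightarrow> bool) \<Rightarrow> nat \<Rightarrow> cantor set" where
  "cylinder \<epsilon> n = {x. \<forall>j\<in>{1..n}. coord x j = \<epsilon> j}"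

lemma diameter_cylinder: "diameter (cylinder \<epsilon> n) = (1/2) ^ n"
proof (rule antisym)
  define x where "x = Abs_cantor (restrict \<epsilon> {1..})"
  define y where "y = Abs_cantor (restrict (\<epsilon>(Suc n := \<not> \<epsilon> (Suc n))) {1..})"
  have x: "coord x = restrict \<epsilon> {1..}"
    unfolding x_def by (rule Abs_cantor_inverse) auto
  have y: "coord y = restrict (\<epsilon>(Suc n := \<not> \<epsilon> (Suc n))) {1..}"
    unfolding y_def by (rule Abs_cantor_inverse) auto
  have mem: "x \<in> cylinder \<epsilon> n" "y \<in> cylinder \<epsilon> n"
    by (auto simp: cylinder_def x y)
  have le: "dist u v \<le> (1/2) ^ n" if "u \<in> cylinder \<epsilon> n" "v \<in> cylinder \<epsilon> n" for u v
    using that unfolding dist_cantor_le_iff by (auto simp: cylinder_def)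
  have neq: "coord x (Suc n) \<noteq> coord y (Suc n)"
    by (simp add: x y)
  have "(LEAST m. coord x (Suc m) \<noteq> coord y (Suc m)) = n"
    by (rule Least_equality) (auto simp: x y split: if_splits)
  then have d: "dist x y = (1/2) ^ n"
    using neq by (auto simp: dist_cantor_def)
  show "diameter (cylinder \<epsilon> n) \<le> (1/2) ^ n"
    unfolding diameter_def using mem by (auto intro!: cSUP_least le)
  have "bounded (cylinder \<epsilon> n)"
    unfolding bounded_def using le mem by blast
  then show "(1/2) ^ n \<le> diameter (cylinder \<epsilon> n)"
    using diameter_bounded_bound[OF _ mem] d by simp
qed

section \<open>Packings and centered covers\<close>

text \<open>A collection of balls is a set of pairs (center, radius): in an ultrametric space a ball
  determines neither its center nor its radius.\<close>

definition delta_packing :: "real \<Rightarrow> 'a::metric_space set \<Rightarrow> ('a \<times> real) set \<Rightarrow> bool" where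
  "delta_packing \<delta> E \<B> \<longleftrightarrow>
     (\<forall>(x, r)\<in>\<B>. x \<in> E \<and> 0 < r \<and> r \<le> \<delta>) \<and> disjoint_family_on (\<lambda>(x, r). ball x r) \<B>"

definition centered_cover :: "real \<Rightarrow> 'a::metric_space set \<Rightarrow> ('a \<times> real) set \<Rightarrow> bool" where
  "centered_cover \<delta> E \<B> \<longleftrightarrow>
     (\<forall>(x, r)\<in>\<B>. x \<in> E \<and> 0 < r \<and> r \<le> \<delta>) \<and> E \<subseteq> (\<Union>(x, r)\<in>\<B>. ball x r)"

section \<open>Hausdorff and packing dimension\<close>

text \<open>\<open>diam(U)\<^sup>s\<close> with the usual conventions \<open>0\<^sup>0 = 1\<close> for nonempty \<open>U\<close>, and \<open>0\<close> for empty \<open>U\<close>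
  (whereas \<^term>\<open>0 powr 0 = (0::real)\<close>).\<close>

definition diam_pow :: "real \<Rightarrow> 'a::metric_space set \<Rightarrow> ennreal" where
  "diam_pow s U = (if U = {} then 0 else if s = 0 then 1 else ennreal (diameter U powr s))"

definition hausdorff_pre :: "real \<Rightarrow> real \<Rightarrow> 'a::metric_space set \<Rightarrow> ennreal" where
  "hausdorff_pre s \<delta> E =
     (INF U\<in>{U :: nat \<Rightarrow> 'a set. (\<forall>i. bounded (U i) \<and> diameter (U i) \<le> \<delta>) \<and> E \<subseteq> (\<Union>i. U i)}.
        \<Sum>i. diam_pow s (U i))"

definition hausdorff_measure :: "real \<Rightarrow> 'a::metric_space set \<Rightarrow> ennreal" where
  "hausdorff_measure s E = Lim (at_right 0) (\<lambda>\<delta>. hausdorff_pre s \<delta> E)"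

definition hausdorff_dim :: "'a::metric_space set \<Rightarrow> ereal" where
  "hausdorff_dim E = Inf (ereal ` {s. 0 \<le> s \<and> hausdorff_measure s E = 0})"

definition packing_pre_delta :: "real \<Rightarrow> real \<Rightarrow> 'a::metric_space set \<Rightarrow> ennreal" where
  "packing_pre_delta s \<delta> E =
     (SUP \<B>\<in>{\<B>. delta_packing \<delta> E \<B>}. \<Sum>\<^sub>\<infinity>(x, r)\<in>\<B>. ennreal (r powr s))"

definition packing_pre :: "real \<Rightarrow> 'a::metric_space set \<Rightarrow> ennreal" where
  "packing_pre s E = Lim (at_right 0) (\<lambda>\<delta>. packing_pre_delta s \<delta> E)"

definition packing_measure :: "real \<Rightarrow> 'a::metric_space set \<Rightarrow> ennreal" where
  "packing_measure s E =
     (INF F\<in>{F :: nat \<Rightarrow> 'a set. E \<subseteq> (\<Union>i. F i)}. \<Sum>i. packing_pre s (F i))"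

definition packing_dim :: "'a::metric_space set \<Rightarrow> ereal" where
  "packing_dim E = Inf (ereal ` {s. 0 \<le> s \<and> packing_measure s E = 0})"

section \<open>Multifractal measures and functions\<close>

definition msupport :: "'a::metric_space measure \<Rightarrow> 'a set" where
  "msupport \<mu> = - \<Union>{ball x r | x r. 0 < r \<and> emeasure \<mu> (ball x r) = 0}"

text \<open>The sum \<open>\<Sum>\<^sup>* r\<^sub>j\<^sup>t \<mu>(B\<^sub>j)\<^sup>q\<close> over the balls of nonzero measure;
  \<open>\<mu>\<close> is meant to be finite on balls.\<close>

definition mf_sum :: "'a::metric_space measure \<Rightarrow> real \<Rightarrow> real \<Rightarrow> ('a \<times> real) set \<Rightarrow> ennreal" where
  "mf_sum \<mu> q t \<B> =
     (\<Sum>\<^sub>\<infinity>(x, r)\<in>{(x, r)\<in>\<B>. measure \<mu> (ball x r) \<noteq> 0}.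
        ennreal (r powr t * measure \<mu> (ball x r) powr q))"

definition mf_packing_pre_delta ::
    "'a::metric_space measure \<Rightarrow> real \<Rightarrow> real \<Rightarrow> real \<Rightarrow> 'a set \<Rightarrow> ennreal" where
  "mf_packing_pre_delta \<mu> q t \<delta> E = (SUP \<B>\<in>{\<B>. delta_packing \<delta> E \<B>}. mf_sum \<mu> q t \<B>)"

definition mf_packing_pre ::
    "'a::metric_space measure \<Rightarrow> real \<Rightarrow> real \<Rightarrow> 'a set \<Rightarrow> ennreal" where
  "mf_packing_pre \<mu> q t E = Lim (at_right 0) (\<lambda>\<delta>. mf_packing_pre_delta \<mu> q t \<delta> E)"

definition mf_packing ::
    "'a::metric_space measure \<Rightarrow> real \<Rightarrow> real \<Rightarrow> 'a set \<Rightarrow> ennreal" where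
  "mf_packing \<mu> q t E =
     (INF F\<in>{F :: nat \<Rightarrow> 'a set. E \<subseteq> (\<Union>i. F i)}. \<Sum>i. mf_packing_pre \<mu> q t (F i))"

definition mf_hausdorff_pre_delta ::
    "'a::metric_space measure \<Rightarrow> real \<Rightarrow> real \<Rightarrow> real \<Rightarrow> 'a set \<Rightarrow> ennreal" where
  "mf_hausdorff_pre_delta \<mu> q t \<delta> E = (INF \<B>\<in>{\<B>. centered_cover \<delta> E \<B>}. mf_sum \<mu> q t \<B>)"

definition mf_hausdorff_pre ::
    "'a::metric_space measure \<Rightarrow> real \<Rightarrow> real \<Rightarrow> 'a set \<Rightarrow> ennreal" where
  "mf_hausdorff_pre \<mu> q t E = Lim (at_right 0) (\<lambda>\<delta>. mf_hausdorff_pre_delta \<mu> q t \<delta> E)"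

definition mf_hausdorff ::
    "'a::metric_space measure \<Rightarrow> real \<Rightarrow> real \<Rightarrow> 'a set \<Rightarrow> ennreal" where
  "mf_hausdorff \<mu> q t E = (SUP F\<in>{F. F \<subseteq> E}. mf_hausdorff_pre \<mu> q t F)"

definition mf_B :: "'a::metric_space measure \<Rightarrow> 'a set \<Rightarrow> real \<Rightarrow> ereal" where
  "mf_B \<mu> E q = Inf (ereal ` {t. mf_packing \<mu> q t E = 0})"

definition mf_b :: "'a::metric_space measure \<Rightarrow> 'a set \<Rightarrow> real \<Rightarrow> ereal" where
  "mf_b \<mu> E q = Inf (ereal ` {t. mf_hausdorff \<mu> q t E = 0})"

definition level_set :: "'a::metric_space measure \<Rightarrow> real \<Rightarrow> 'a set" where
  "level_set \<mu> \<alpha> = {x. ((\<lambda>r. ln (measure \<mu> (ball x r)) / ln r) \<longlongrightarrow> \<alpha>) (at_right 0)}"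

definition left_deriv :: "(real \<Rightarrow> real) \<Rightarrow> real \<Rightarrow> real" where
  "left_deriv f x = Lim (at_left x) (\<lambda>y. (f y - f x) / (y - x))"

definition right_deriv :: "(real \<Rightarrow> real) \<Rightarrow> real \<Rightarrow> real" where
  "right_deriv f x = Lim (at_right x) (\<lambda>y. (f y - f x) / (y - x))"

end

theory Submission
  imports Defs "HOL-Real_Asymp.Real_Asymp"
begin

text \<open>
  Write \<open>\<theta>\<^sub>u(q) = log\<^sub>2(u\<^sup>q + (1 - u)\<^sup>q)\<close>. On blocks ruled by \<open>u \<in> {p, pt}\<close> give the symbol \<open>\<epsilon>\<close> the Gibbs weight
  \<open>\<varpi>(\<epsilon>)\<^sup>q 2\<^sup>-\<^sup>\<theta>\<close>, with \<open>q = q\<^sub>u\<close> chosen such that the mean of \<open>- log\<^sub>2 \<varpi>\<close> is \<open>\<alpha>\<close>. By the strong law the resulting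
  product measure lives on the level set, and its local entropy is the running average of
  \<open>h\<^sub>u = \<theta>\<^sub>u(q\<^sub>u) + \<alpha> q\<^sub>u\<close>. As each block dwarfs its predecessors, the mass distribution principle bounds the
  Hausdorff dimension below by the smaller and the packing dimension below by the larger of the two \<open>h\<^sub>u\<close>.

  Conversely, Hausdorff and packing dimension of the level set are at most \<open>b(q) + \<alpha> q\<close> and \<open>B(q) + \<alpha> q\<close> for
  every \<open>q\<close>. Covering by cylinders gives \<open>b \<le> min(\<theta>\<^sub>p, \<theta>\<^sub>p\<^sub>t)\<close>, which settles the first claim at \<open>q = q\<^sub>u\<close>.
  Moreover \<open>B = max(\<theta>\<^sub>p, \<theta>\<^sub>p\<^sub>t)\<close>, which is \<open>\<theta>\<^sub>p\<^sub>t\<close> on \<open>[0, 1]\<close> and \<open>\<theta>\<^sub>p\<close> elsewhere; the upper bound therefore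
  matches unless \<open>q\<^sub>p \<in> (0, 1)\<close> and \<open>q\<^sub>p\<^sub>t \<notin> [0, 1]\<close>, and in that case \<open>- \<alpha>\<close> lies between the one-sided
  derivatives of \<open>B\<close> at \<open>0\<close> or at \<open>1\<close>.
\<close>

section \<open>Cylinders and balls\<close>

lemma mem_cylinder_coord [simp]: "x \<in> cylinder (coord x) n"
  by (simp add: cylinder_def)

lemma cylinder_cong: "(\<And>j. j \<in> {1..n} \<Longrightarrow> \<epsilon> j = \<epsilon>' j) \<Longrightarrow> cylinder \<epsilon> n = cylinder \<epsilon>' n"
  by (auto simp: cylinder_def)

lemma mem_cylinder_coord_iff: "y \<in> cylinder (coord x) n \<longleftrightarrow> dist x y \<le> (1/2) ^ n"
  unfolding cylinder_def dist_cantor_le_iff by auto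

lemma cylinder_eq_of_mem: "y \<in> cylinder \<epsilon> n \<Longrightarrow> cylinder (coord y) n = cylinder \<epsilon> n"
  by (auto simp: cylinder_def)

lemma coord_Abs_cantor: "f \<in> {1..} \<rightarrow>\<^sub>E UNIV \<Longrightarrow> coord (Abs_cantor f) = f"
  by (rule Abs_cantor_inverse)

lemma cylinder_nonempty: "cylinder \<epsilon> n \<noteq> {}"
proof -
  have "Abs_cantor (restrict \<epsilon> {1..}) \<in> cylinder \<epsilon> n"
    by (auto simp: cylinder_def coord_Abs_cantor)
  then show ?thesis by blast
qed

lemma dist_cantor_less_iff: "dist x y < 2 * (1/2) ^ n \<longleftrightarrow> n = 0 \<or> dist x y \<le> (1/2) ^ n"
  for x y :: cantor
proof (cases "x = y")
  case False
  then obtain k where k: "dist x y = (1/2) ^ k" by (auto simp: dist_cantor_def)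
  have "(1/2::real) ^ k \<le> 1" by (rule power_le_one) auto
  show ?thesis
  proof (cases n)
    case 0
    then show ?thesis using \<open>(1/2::real) ^ k \<le> 1\<close> k by simp
  next
    case (Suc m)
    have "dist x y < 2 * (1/2) ^ n \<longleftrightarrow> (1/2::real) ^ k < (1/2) ^ m" by (simp add: k Suc)
    also have "\<dots> \<longleftrightarrow> m < k" by (rule power_strict_decreasing_iff) auto
    also have "\<dots> \<longleftrightarrow> n \<le> k" using Suc by auto
    also have "\<dots> \<longleftrightarrow> (1/2::real) ^ k \<le> (1/2) ^ n" by (simp add: power_decreasing_iff)
    finally show ?thesis by (simp add: k Suc)
  qed
qed auto

text \<open>Nonzero distances are powers of 1/2 and the ball is open, so radius 2^(1 - n) admits
  exactly the distances up to 2^-n. The packings and covers constructed below all use this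
  radius.\<close>

lemma ball_eq_cylinder: "ball x (2 * (1/2) ^ n) = cylinder (coord x) n" for x :: cantor
proof (cases "n = 0")
  case True
  then show ?thesis
    using dist_cantor_less_iff[of x _ 0] by (auto simp: cylinder_def)
next
  case False
  then show ?thesis
    by (auto simp: set_eq_iff mem_cylinder_coord_iff dist_cantor_less_iff)
qed

text \<open>Sorts the radii in (0, 1] by the order n of the cylinder that their balls are, see
  \<open>ball_cantor_eq_cylinder\<close>.\<close>

lemma dyadic_bracket:
  fixes r :: real
  assumes "0 < r" "r \<le> 1"
  obtains n where "(1/2) ^ n < r" "r \<le> 2 * (1/2) ^ n"
proof -
  define n where "n = (LEAST n. (1/2) ^ n < r)"
  have "\<exists>n. (1/2) ^ n < r" using real_arch_pow_inv[of r "1/2"] assms by auto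
  then have n: "(1/2) ^ n < r" unfolding n_def by (rule LeastI_ex)
  then have "n \<noteq> 0" using assms by (cases n) auto
  then obtain m where m: "n = Suc m" by (cases n) auto
  have "\<not> (1/2) ^ m < r"
    using not_less_Least[of m "\<lambda>n. (1/2) ^ n < r"] m unfolding n_def by auto
  then show thesis using that[OF n] by (simp add: m)
qed

lemma ball_cantor_eq_cylinder:
  assumes "(1/2) ^ n < r" "r \<le> 2 * (1/2) ^ n"
  shows "ball x r = cylinder (coord x) n"
proof -
  have "ball x r \<subseteq> ball x (2 * (1/2) ^ n)" using assms by (intro subset_ball)
  moreover have "cylinder (coord x) n \<subseteq> ball x r"
    using assms by (auto simp: mem_cylinder_coord_iff)
  ultimately show ?thesis by (auto simp: ball_eq_cylinder)
qed

lemma open_cylinder: "open (cylinder \<epsilon> n)"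
proof -
  obtain x where "x \<in> cylinder \<epsilon> n" using cylinder_nonempty by blast
  then have "cylinder \<epsilon> n = ball x (2 * (1/2) ^ n)"
    unfolding ball_eq_cylinder by (rule cylinder_eq_of_mem[symmetric])
  then show ?thesis by simp
qed

text \<open>Extensional functions, so that every cylinder of order n is indexed by exactly one
  word.\<close>

abbreviation words :: "nat \<Rightarrow> (nat \<Rightarrow> bool) set" where
  "words n \<equiv> {1..n} \<rightarrow>\<^sub>E UNIV"

lemma finite_words: "finite (words n)"
  by (intro finite_PiE) auto

text \<open>Expanding a product over positions: this factorises the partition sum of a product
  measure into one-symbol sums.\<close>

lemma sum_words: 
  fixes f :: "nat \<Rightarrow> bool \<Rightarrow> real"
  shows "(\<Sum>\<epsilon>\<in>words n. \<Prod>j=1..n. f j (\<epsilon> j)) = (\<Prod>j=1..n. f j True + f j False)"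
  by (subst prod_sum_PiE[symmetric]) (auto simp: UNIV_bool add.commute)

lemma cylinder_restrict: "cylinder (restrict \<epsilon> {1..n}) n = cylinder \<epsilon> n"
  by (rule cylinder_cong) auto

text \<open>Besides measurability, this serves to thin out a possibly uncountable centered cover in
  \<open>ex_enumeration_of_cover\<close>.\<close>

lemma countable_cylinders: "countable (range (\<lambda>(\<epsilon>, n). cylinder \<epsilon> n))"
proof -
  have "range (\<lambda>(\<epsilon>, n). cylinder \<epsilon> n) \<subseteq> (\<Union>n. (\<lambda>\<epsilon>. cylinder \<epsilon> n) ` words n)"
  proof clarify
    fix \<epsilon> n
    have "restrict \<epsilon> {1..n} \<in> words n" by auto
    then show "cylinder \<epsilon> n \<in> (\<Union>n. (\<lambda>\<epsilon>. cylinder \<epsilon> n) ` words n)"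
      using cylinder_restrict[of \<epsilon> n] by blast
  qed
  then show ?thesis
    by (rule countable_subset) (rule countable_UN, simp, intro countable_finite finite_imageI finite_words)
qed

section \<open>Borel sets of the sequence space\<close>

lemma open_cantor_Union_cylinders:
  assumes "open S"
  obtains \<C> where "countable \<C>" "\<C> \<subseteq> range (\<lambda>(\<epsilon>, n). cylinder \<epsilon> n)" "S = \<Union>\<C>"
proof
  define \<C> where "\<C> = {C \<in> range (\<lambda>(\<epsilon>, n). cylinder \<epsilon> n). C \<subseteq> S}"
  show "countable \<C>" unfolding \<C>_def by (rule countable_subset[OF _ countable_cylinders]) auto
  show "\<C> \<subseteq> range (\<lambda>(\<epsilon>, n). cylinder \<epsilon> n)" by (auto simp: \<C>_def)
  show "S = \<Union>\<C>"
  proof (intro equalityI subsetI)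
    fix x assume "x \<in> S"
    then obtain e where e: "0 < e" "ball x e \<subseteq> S" using assms open_contains_ball by blast
    obtain n where "(1/2) ^ n < e" using real_arch_pow_inv[of e "1/2"] e by auto
    then have "cylinder (coord x) n \<subseteq> ball x e" by (auto simp: mem_cylinder_coord_iff)
    then have "cylinder (coord x) n \<in> \<C>" using e by (auto simp: \<C>_def)
    then show "x \<in> \<Union>\<C>" using mem_cylinder_coord by blast
  qed (auto simp: \<C>_def)
qed

text \<open>An open set is a countable union of cylinders, and the preimage of a cylinder constrains
  only finitely many coordinates.\<close>

lemma measurable_Abs_cantor:
  "Abs_cantor \<in> borel_measurable (PiM {1..} (\<lambda>j. measure_pmf (P j)))"
proof (rule borel_measurableI)
  let ?M = "PiM {1..} (\<lambda>j. measure_pmf (P j))"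
  fix S :: "cantor set" assume "open S"
  then obtain \<C> where \<C>: "countable \<C>" "\<C> \<subseteq> range (\<lambda>(\<epsilon>, n). cylinder \<epsilon> n)" "S = \<Union>\<C>"
    by (rule open_cantor_Union_cylinders)
  have "Abs_cantor -` C \<inter> space ?M \<in> sets ?M" if C: "C \<in> \<C>" for C
  proof -
    obtain \<epsilon> n where C: "C = cylinder \<epsilon> n" using C \<C> by auto
    have "Abs_cantor -` C \<inter> space ?M = {x \<in> space ?M. \<forall>j\<in>{1..n}. x j = \<epsilon> j}"
      by (auto simp: C cylinder_def space_PiM coord_Abs_cantor)
    also have "\<dots> = prod_emb {1..} (\<lambda>j. measure_pmf (P j)) {1..n} (Pi\<^sub>E {1..n} (\<lambda>j. {\<epsilon> j}))"
      by (auto simp: space_PiM prod_emb_def PiE_iff extensional_def)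
    also have "\<dots> \<in> sets ?M" by (rule sets_PiM_I) auto
    finally show ?thesis .
  qed
  then have "(\<Union>C\<in>\<C>. Abs_cantor -` C \<inter> space ?M) \<in> sets ?M"
    using \<C>(1) by (intro sets.countable_UN') auto
  then show "Abs_cantor -` S \<inter> space ?M \<in> sets ?M"
    by (simp add: \<C> vimage_Union)
qed

lemma cylinder_sets_borel [measurable]: "cylinder \<epsilon> n \<in> sets borel"
  by (rule borel_open[OF open_cylinder])

lemma measurable_coord:
  assumes "j \<ge> 1"
  shows "(\<lambda>x. coord x j) \<in> measurable borel (count_space UNIV)"
proof (rule measurable_count_space_eq2_countable[THEN iffD2])
  have "(\<lambda>x. coord x j) -` {a} \<inter> space borel = (\<Union>\<epsilon>\<in>{\<epsilon>\<in>words j. \<epsilon> j = a}. cylinder \<epsilon> j)" for a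
  proof (intro equalityI subsetI)
    fix x assume "x \<in> (\<lambda>x. coord x j) -` {a} \<inter> space borel"
    then have "restrict (coord x) {1..j} \<in> {\<epsilon>\<in>words j. \<epsilon> j = a}"
        "x \<in> cylinder (restrict (coord x) {1..j}) j"
      using assms by (auto simp: cylinder_def)
    then show "x \<in> (\<Union>\<epsilon>\<in>{\<epsilon>\<in>words j. \<epsilon> j = a}. cylinder \<epsilon> j)" by blast
  next
    fix x assume "x \<in> (\<Union>\<epsilon>\<in>{\<epsilon>\<in>words j. \<epsilon> j = a}. cylinder \<epsilon> j)"
    then show "x \<in> (\<lambda>x. coord x j) -` {a} \<inter> space borel" using assms by (auto simp: cylinder_def)
  qed
  moreover have "(\<Union>\<epsilon>\<in>{\<epsilon>\<in>words j. \<epsilon> j = a}. cylinder \<epsilon> j) \<in> sets borel" for a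
    using finite_words[of j] by (intro sets.finite_UN) auto
  ultimately show "(\<lambda>x. coord x j) \<in> space borel \<rightarrow> UNIV \<and>
      (\<forall>a\<in>UNIV. (\<lambda>x. coord x j) -` {a} \<inter> space borel \<in> sets borel)" by simp
qed

lemma borel_measurable_coord_sum [measurable]:
  fixes f :: "nat \<Rightarrow> bool \<Rightarrow> real"
  shows "(\<lambda>x. \<Sum>j=1..n. f j (coord x j)) \<in> borel_measurable borel"
proof (rule borel_measurable_sum)
  fix j assume "j \<in> {1..n}"
  then have [measurable]: "(\<lambda>x. coord x j) \<in> measurable borel (count_space UNIV)"
    by (intro measurable_coord) auto
  show "(\<lambda>x. f j (coord x j)) \<in> borel_measurable borel"
    by (rule measurable_compose[of "\<lambda>x. coord x j" _ "count_space UNIV"]) simp_all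
qed

section \<open>Product measures and the strong law\<close>

text \<open>Hoeffding's inequality bounds the probability of a deviation
  \<open>\<epsilon> * n\<close> by a summable geometric sequence, and Borel-Cantelli turns this into
  almost sure convergence even though the factors \<open>P j\<close> vary with
  \<open>j\<close>.\<close>

lemma strong_law_PiM:
  fixes f :: "nat \<Rightarrow> 'a \<Rightarrow> real" and P :: "nat \<Rightarrow> 'a pmf"
  assumes bnd: "\<And>j e. \<bar>f j e\<bar> \<le> C"
  shows "AE x in PiM {1..} (\<lambda>j. measure_pmf (P j)).
     (\<lambda>n. (\<Sum>j=1..n. f j (x j) - measure_pmf.expectation (P j) (f j)) / real n) \<longlonglongrightarrow> 0"
proof -
  note One_nat_def [simp del]
  let ?M = "PiM {1..} (\<lambda>j. measure_pmf (P j))"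
  interpret product_prob_space "\<lambda>j. measure_pmf (P j)" "{1..}"
    by unfold_locales
  \<comment> \<open>Adding 1 keeps the Hoeffding interval [-K, K] nondegenerate when
    \<open>C = 0\<close>.\<close>
  define K where "K = \<bar>C\<bar> + 1"
  have K: "K > 0" "\<And>j e. f j e \<in> {-K..K}" 
    subgoal by (simp add: K_def)
    subgoal for j e using bnd[of j e] by (auto simp: K_def)
    done
  define X where "X = (\<lambda>(j::nat) (x::nat \<Rightarrow> 'a). f j (x j))"
  have X[measurable]: "X j \<in> borel_measurable ?M" if "j \<in> {1..}" for j
    unfolding X_def using that by (intro measurable_compose[OF measurable_component_singleton]) auto
  have comp: "distr ?M (measure_pmf (P j)) (\<lambda>x. x j) = measure_pmf (P j)" if "j \<in> {1..}" for j
    using PiM_component[OF that] .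
  \<comment> \<open>The joint law of the coordinates is \<open>?M\<close> itself, that is, the
    product of their marginals.\<close>
  have ind0: "P.indep_vars (\<lambda>j. measure_pmf (P j)) (\<lambda>j x. x j) {1..}"
  proof (subst P.indep_vars_iff_distr_eq_PiM')
    show "distr ?M (\<Pi>\<^sub>M i\<in>{1..}. measure_pmf (P i)) (\<lambda>x. \<lambda>i\<in>{1..}. x i)
       = (\<Pi>\<^sub>M i\<in>{1..}. distr ?M (measure_pmf (P i)) (\<lambda>x. x i))"
    proof -
      have "distr ?M ?M (\<lambda>x. \<lambda>i\<in>{1..}. x i) = distr ?M ?M (\<lambda>x. x)"
        by (rule distr_cong) (auto simp: space_PiM)
      also have "\<dots> = (\<Pi>\<^sub>M i\<in>{1..}. distr ?M (measure_pmf (P i)) (\<lambda>x. x i))"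
        unfolding distr_id by (rule PiM_cong) (use comp in auto)
      finally show ?thesis .
    qed
  qed auto
  have ind: "P.indep_vars (\<lambda>_. borel) X {1..n}" for n
    unfolding X_def
    by (rule P.indep_vars_compose2[OF P.indep_vars_subset[OF ind0]]) auto
  have ex: "P.expectation (X j) = measure_pmf.expectation (P j) (f j)" if "j \<in> {1..}" for j
  proof -
    have "measure_pmf.expectation (P j) (f j) = integral\<^sup>L (distr ?M (measure_pmf (P j)) (\<lambda>x. x j)) (f j)"
      by (simp only: comp[OF that])
    also have "\<dots> = P.expectation (X j)" unfolding X_def
      using that by (subst integral_distr) auto
    finally show ?thesis ..
  qed
  define D where "D = (\<lambda>n x. \<Sum>j=1..n. X j x - measure_pmf.expectation (P j) (f j))"
  have [measurable]: "D n \<in> borel_measurable ?M" for n unfolding D_def by measurable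
  \<comment> \<open>Hoeffding with n intervals of length 2K has exponent -2 (\<epsilon> n)^2 / (4 n
    K^2). For n = 0 the right-hand side is 2, which bounds any probability.\<close>
  have bound: "measure ?M {x\<in>space ?M. \<bar>D n x\<bar> \<ge> \<epsilon> * n} \<le> 2 * exp (- (\<epsilon>\<^sup>2 / (2 * K\<^sup>2))) ^ n"
    if "\<epsilon> > 0" for n and \<epsilon> :: real
  proof (cases "n = 0")
    case True
    then show ?thesis by (intro order.trans[OF P.prob_le_1]) simp
  next
    case False
    interpret H: Hoeffding_ineq ?M "{1..n}" X "\<lambda>_. -K" "\<lambda>_. K" "\<Sum>j=1..n. P.expectation (X j)"
      by unfold_locales (use ind K in \<open>auto simp: X_def\<close>)
    have "measure ?M {x\<in>space ?M. \<bar>D n x\<bar> \<ge> \<epsilon> * n} =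
        measure ?M {x\<in>space ?M. \<bar>(\<Sum>j=1..n. X j x) - (\<Sum>j=1..n. P.expectation (X j))\<bar> \<ge> \<epsilon> * n}"
      unfolding D_def sum_subtractf using ex by simp
    also have "\<dots> \<le> 2 * exp (-2 * (\<epsilon> * n)\<^sup>2 / (\<Sum>i=1..n. (K - (-K))\<^sup>2))"
      using that False K by (intro H.Hoeffding_ineq_abs_ge) auto
    also have "-2 * (\<epsilon> * n)\<^sup>2 / (\<Sum>i=1..n. (K - (-K))\<^sup>2) = real n * (- (\<epsilon>\<^sup>2 / (2 * K\<^sup>2)))"
      using False K by (simp add: field_simps power2_eq_square)
    also have "exp \<dots> = exp (- (\<epsilon>\<^sup>2 / (2 * K\<^sup>2))) ^ n"
      by (rule exp_of_nat_mult)
    finally show ?thesis .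
  qed
  have ae: "AE x in ?M. \<forall>\<^sub>F n in sequentially. \<bar>D n x\<bar> < \<epsilon> * n" if "\<epsilon> > 0" for \<epsilon> :: real
  proof -
    have "summable (\<lambda>n. 2 * exp (- (\<epsilon>\<^sup>2 / (2 * K\<^sup>2))) ^ n)"
      using that K by (intro summable_mult summable_geometric) auto
    then have "summable (\<lambda>n. measure ?M {x\<in>space ?M. \<bar>D n x\<bar> \<ge> \<epsilon> * n})"
      by (rule summable_comparison_test'[of _ 0]) (use bound[OF that] in auto)
    then have "AE x in ?M. \<forall>\<^sub>F n in sequentially. x \<in> space ?M - {x\<in>space ?M. \<bar>D n x\<bar> \<ge> \<epsilon> * n}"
      by (intro borel_cantelli_AE1) (auto simp: P.emeasure_eq_measure)
    then show ?thesis by eventually_elim (auto elim: eventually_mono)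
  qed
  \<comment> \<open>Countably many tolerances 1/(k + 1) suffice, so the exceptional null sets can be
    united.\<close>
  have "AE x in ?M. \<forall>k::nat. \<forall>\<^sub>F n in sequentially. \<bar>D n x\<bar> < inverse (real (Suc k)) * n"
    unfolding AE_all_countable
  proof
    fix k :: nat
    show "AE x in ?M. \<forall>\<^sub>F n in sequentially. \<bar>D n x\<bar> < inverse (real (Suc k)) * n"
      by (rule ae) simp
  qed
  then show ?thesis
  proof eventually_elim
    case (elim x)
    show ?case
    proof (rule LIMSEQ_I)
      fix r :: real assume "r > 0"
      then obtain k where k: "inverse (real (Suc k)) < r" using reals_Archimedean by blast
      have "\<forall>\<^sub>F n in sequentially. norm (D n x / n - 0) < r"
        using elim[rule_format, of k] eventually_gt_at_top[of 0]
      proof eventually_elim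
        case (elim n)
        then have "\<bar>D n x\<bar> / n < inverse (real (Suc k))" by (simp add: pos_divide_less_eq)
        then show ?case using k by simp
      qed
      then show "\<exists>no. \<forall>n\<ge>no. norm ((\<Sum>j=1..n. f j (x j) - measure_pmf.expectation (P j) (f j)) / n - 0) < r"
        unfolding D_def X_def eventually_sequentially .
    qed
  qed
qed

text \<open>The witness is the law of independent coins showing \<open>True\<close> with probability
  \<open>w j True\<close>, transported by \<open>Abs_cantor\<close>. The last clause is the strong
  law; it is applied later both to the local dimension of \<open>\<mu>\<close> and to the entropy of
  the new measure.\<close>

lemma ex_product_measure:
  fixes w :: "nat \<Rightarrow> bool \<Rightarrow> real"
  assumes nn: "\<And>j e. 0 \<le> w j e" and one: "\<And>j. w j True + w j False = 1"
  obtains N where "prob_space N" "sets N = sets borel"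
    "\<And>\<epsilon> n. measure N (cylinder \<epsilon> n) = (\<Prod>j=1..n. w j (\<epsilon> j))"
    "\<And>f C. (\<And>j e. \<bar>f j e\<bar> \<le> C) \<Longrightarrow>
       AE x in N. (\<lambda>n. (\<Sum>j=1..n. f j (coord x j) - (w j True * f j True + w j False * f j False)) / real n)
         \<longlonglongrightarrow> (0::real)"
proof -
  note One_nat_def [simp del]
  define P where "P = (\<lambda>j. bernoulli_pmf (w j True))"
  let ?M = "PiM {1..} (\<lambda>j. measure_pmf (P j))"
  interpret product_prob_space "\<lambda>j. measure_pmf (P j)" "{1..}"
    by unfold_locales
  have w1: "w j True \<le> 1" "w j True \<ge> 0" "w j False = 1 - w j True" for j 
    using nn[of j False] nn[of j True] one[of j] by auto
  have pmfP: "pmf (P j) e = w j e" for j e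
    using w1[of j] by (cases e) (auto simp: P_def)
  note [measurable] = measurable_Abs_cantor[of P]
  define N where "N = distr ?M borel Abs_cantor"
  show thesis
  proof
    show "prob_space N" unfolding N_def by (rule P.prob_space_distr) measurable
    show "sets N = sets borel" by (simp add: N_def)
  next
    fix \<epsilon> n
    have "measure N (cylinder \<epsilon> n) = measure ?M (Abs_cantor -` cylinder \<epsilon> n \<inter> space ?M)"
      unfolding N_def by (rule measure_distr[OF measurable_Abs_cantor]) auto
    also have "Abs_cantor -` cylinder \<epsilon> n \<inter> space ?M
        = prod_emb {1..} (\<lambda>j. measure_pmf (P j)) {1..n} (Pi\<^sub>E {1..n} (\<lambda>j. {\<epsilon> j}))"
      by (auto simp: cylinder_def space_PiM coord_Abs_cantor prod_emb_def PiE_iff)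
    also have "measure ?M \<dots> = (\<Prod>j=1..n. measure (P j) {\<epsilon> j})"
      by (rule measure_PiM_emb) auto
    finally show "measure N (cylinder \<epsilon> n) = (\<Prod>j=1..n. w j (\<epsilon> j))"
      by (simp add: measure_pmf_single pmfP)
  next
    fix f :: "nat \<Rightarrow> bool \<Rightarrow> real" and C assume bnd: "\<And>j e. \<bar>f j e\<bar> \<le> C"
    have E: "measure_pmf.expectation (P j) (f j) = w j True * f j True + w j False * f j False" for j
      using w1[of j] by (simp add: P_def integral_bernoulli_pmf)
    have "AE x in ?M. (\<lambda>n. (\<Sum>j=1..n. f j (coord (Abs_cantor x) j) -
        (w j True * f j True + w j False * f j False)) / real n) \<longlonglongrightarrow> 0"
      using strong_law_PiM[where P=P and f=f, OF bnd] AE_space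
      by eventually_elim (simp add: E coord_Abs_cantor space_PiM)
    then show "AE x in N. (\<lambda>n. (\<Sum>j=1..n. f j (coord x j) -
        (w j True * f j True + w j False * f j False)) / real n) \<longlonglongrightarrow> 0"
      unfolding N_def
    proof (subst AE_distr_iff)
      \<comment> \<open>\<open>AE_distr_iff\<close> asks for the set of convergence to be
        Borel.\<close>
      have "(\<lambda>x. (\<Sum>j=1..n. f j (coord x j) - (w j True * f j True + w j False * f j False)) / real n)
          \<in> borel_measurable borel" for n
        using borel_measurable_coord_sum[of
            "\<lambda>j e. f j e - (w j True * f j True + w j False * f j False)" n] by simp
      then show "{x \<in> space borel. (\<lambda>n. (\<Sum>j=1..n. f j (coord x j) -
          (w j True * f j True + w j False * f j False)) / real n) \<longlonglongrightarrow> 0} \<in> sets borel"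
        by (intro predE measurable_limit)
    qed (use measurable_Abs_cantor in auto)
  qed
qed

section \<open>Limits of premeasures\<close>

text \<open>\<open>Lim\<close> is meaningful only where a limit exists. Monotonicity in the scale
  supplies the limit and identifies it with an extremum over all scales, which is easier to
  bound.\<close>

lemma Lim_at_right_antimono_ennreal:
  fixes f :: "real \<Rightarrow> ennreal"
  assumes "\<And>d d'. 0 < d \<Longrightarrow> d \<le> d' \<Longrightarrow> f d' \<le> f d"
  shows "Lim (at_right 0) f = (SUP d\<in>{0<..}. f d)"
proof (rule tendsto_Lim)
  show "(f \<longlongrightarrow> (SUP d\<in>{0<..}. f d)) (at_right 0)"
  proof (rule order_tendstoI)
    fix a assume "a < (SUP d\<in>{0<..}. f d)"
    then obtain d where d: "0 < d" "a < f d" by (auto simp: less_SUP_iff)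
    show "\<forall>\<^sub>F x in at_right 0. a < f x"
      using eventually_at_right_real[OF d(1)]
      by eventually_elim (rule less_le_trans[OF d(2) assms], auto)
  next
    fix a assume a: "(SUP d\<in>{0<..}. f d) < a"
    show "\<forall>\<^sub>F x in at_right 0. f x < a"
      using eventually_at_right_less[of "0::real"]
      by eventually_elim (rule le_less_trans[OF SUP_upper a], simp)
  qed
qed simp

lemma Lim_at_right_mono_ennreal:
  fixes f :: "real \<Rightarrow> ennreal"
  assumes "\<And>d d'. 0 < d \<Longrightarrow> d \<le> d' \<Longrightarrow> f d \<le> f d'"
  shows "Lim (at_right 0) f = (INF d\<in>{0<..}. f d)"
proof (rule tendsto_Lim)
  show "(f \<longlongrightarrow> (INF d\<in>{0<..}. f d)) (at_right 0)"
  proof (rule order_tendstoI)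
    fix a assume "(INF d\<in>{0<..}. f d) < a"
    then obtain d where d: "0 < d" "f d < a" by (auto simp: INF_less_iff)
    show "\<forall>\<^sub>F x in at_right 0. f x < a"
      using eventually_at_right_real[OF d(1)]
      by eventually_elim (rule le_less_trans[OF assms d(2)], auto)
  next
    fix a assume a: "a < (INF d\<in>{0<..}. f d)"
    show "\<forall>\<^sub>F x in at_right 0. a < f x"
      using eventually_at_right_less[of "0::real"]
      by eventually_elim (rule less_le_trans[OF a INF_lower], simp)
  qed
qed simp

lemma hausdorff_measure_eq_SUP: "hausdorff_measure s E = (SUP \<delta>\<in>{0<..}. hausdorff_pre s \<delta> E)"
  unfolding hausdorff_measure_def
  by (rule Lim_at_right_antimono_ennreal, unfold hausdorff_pre_def, rule INF_superset_mono)
     (auto intro: order_trans)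

lemma mf_hausdorff_pre_eq_SUP:
  "mf_hausdorff_pre \<mu> q t E = (SUP \<delta>\<in>{0<..}. mf_hausdorff_pre_delta \<mu> q t \<delta> E)"
  unfolding mf_hausdorff_pre_def
  by (rule Lim_at_right_antimono_ennreal, unfold mf_hausdorff_pre_delta_def centered_cover_def,
      rule INF_superset_mono) force+

lemma packing_pre_delta_mono:
  "E \<subseteq> E' \<Longrightarrow> d \<le> d' \<Longrightarrow> packing_pre_delta s d E \<le> packing_pre_delta s d' E'"
  unfolding packing_pre_delta_def delta_packing_def by (rule SUP_subset_mono) force+

lemma mf_packing_pre_delta_mono:
  "E \<subseteq> E' \<Longrightarrow> d \<le> d' \<Longrightarrow> mf_packing_pre_delta \<mu> q t d E \<le> mf_packing_pre_delta \<mu> q t d' E'"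
  unfolding mf_packing_pre_delta_def delta_packing_def by (rule SUP_subset_mono) force+

lemma packing_pre_eq_INF: "packing_pre s E = (INF \<delta>\<in>{0<..}. packing_pre_delta s \<delta> E)"
  unfolding packing_pre_def
  by (rule Lim_at_right_mono_ennreal) (simp add: packing_pre_delta_mono)

lemma mf_packing_pre_eq_INF:
  "mf_packing_pre \<mu> q t E = (INF \<delta>\<in>{0<..}. mf_packing_pre_delta \<mu> q t \<delta> E)"
  unfolding mf_packing_pre_def
  by (rule Lim_at_right_mono_ennreal) (simp add: mf_packing_pre_delta_mono)

lemma mf_sum_leI:
  assumes "\<And>F. finite F \<Longrightarrow> F \<subseteq> \<B> \<Longrightarrow>
    (\<Sum>(x, r)\<in>F. ennreal (r powr t * measure \<mu> (ball x r) powr q)) \<le> c"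
  shows "mf_sum \<mu> q t \<B> \<le> c"
  unfolding mf_sum_def
  by (subst nonneg_infsum_complete) (auto intro!: SUP_least assms)

lemma sum_le_mf_sum:
  assumes "finite F" "F \<subseteq> \<B>" "\<And>x r. (x, r) \<in> F \<Longrightarrow> measure \<mu> (ball x r) \<noteq> 0"
  shows "(\<Sum>(x, r)\<in>F. ennreal (r powr t * measure \<mu> (ball x r) powr q)) \<le> mf_sum \<mu> q t \<B>"
  unfolding mf_sum_def
  by (subst nonneg_infsum_complete, simp, rule SUP_upper) (use assms in auto)

text \<open>For q = 0 a ball of positive measure contributes the factor 1. Hence
  \<open>mf_packing_nonzero\<close> yields lower bounds both for B and for packing
  dimension.\<close>

lemma packing_measure_eq_mf_packing:
  assumes pos: "\<And>x r. 0 < r \<Longrightarrow> measure \<mu> (ball x r) > 0"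
  shows "packing_measure s E = mf_packing \<mu> 0 s E"
proof -
  have "packing_pre_delta s \<delta> E = mf_packing_pre_delta \<mu> 0 s \<delta> E" for \<delta> and E :: "'a set"
    unfolding packing_pre_delta_def mf_packing_pre_delta_def
  proof (rule SUP_cong)
    fix \<B> assume "\<B> \<in> {\<B>. delta_packing \<delta> E \<B>}"
    then have nz: "measure \<mu> (ball x r) \<noteq> 0" if "(x, r) \<in> \<B>" for x r
      using pos[of r x] that by (auto simp: delta_packing_def)
    show "(\<Sum>\<^sub>\<infinity>(x, r)\<in>\<B>. ennreal (r powr s)) = mf_sum \<mu> 0 s \<B>"
      unfolding mf_sum_def by (rule infsum_cong_neutral) (use nz in auto)
  qed simp
  then show ?thesis
    unfolding packing_measure_def mf_packing_def packing_pre_def mf_packing_pre_def by simp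
qed

lemma suminf_ennreal_halves: "0 \<le> c \<Longrightarrow> (\<Sum>i. ennreal (c * (1/2) ^ Suc i)) = ennreal c"
  using sums_mult[OF power_half_series, of c]
  by (subst suminf_ennreal2) (auto simp: sums_iff)

lemma ex_geometric_less: "0 < e \<Longrightarrow> \<exists>n\<ge>m. C * \<rho> ^ n < e" if "0 \<le> \<rho>" "\<rho> < 1" for e C \<rho> :: real
proof -
  assume "0 < e"
  have "(\<lambda>n. C * \<rho> ^ n) \<longlonglongrightarrow> C * 0"
    using that by (intro tendsto_intros) auto
  then have "\<forall>\<^sub>F n in sequentially. C * \<rho> ^ n < e"
    using \<open>0 < e\<close> by (simp add: order_tendstoD)
  then have "\<forall>\<^sub>F n in sequentially. n \<ge> m \<and> C * \<rho> ^ n < e"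
    using eventually_ge_at_top[of m] by eventually_elim simp
  then show ?thesis by (auto simp: eventually_sequentially)
qed

lemma half_power_powr: "((1/2::real) ^ n) powr s = 2 powr (- (s * real n))"
proof -
  have "(1/2::real) ^ n = 2 powr (- real n)"
    by (simp add: powr_minus powr_realpow power_one_over inverse_eq_divide)
  then show ?thesis by (simp add: powr_powr mult.commute)
qed

lemma half_power_powr': "((1/2::real) ^ n) powr s = (2 powr (- s)) ^ n"
  unfolding half_power_powr by (simp add: powr_realpow[symmetric] powr_powr)

section \<open>Mass distribution\<close>

text \<open>A set of diameter d > 0 lies in the cylinder about x of order k with d \<le> 2^-k < 2 d,
  which costs the factor 2^s'. A set of diameter 0 may have \<open>diam_pow s U = 0\<close>; it is
  put into a cylinder so deep that the mass drops below \<open>\<eta>\<close>.\<close>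

lemma cylinder_mass_le_diam_pow:
  fixes U :: "cantor set"
  assumes s: "s < s'" "0 < s'" and U: "bounded U" "diameter U \<le> (1/2) ^ Suc m" "x \<in> U" and "0 < \<eta>"
    and dens: "\<And>n. n \<ge> m \<Longrightarrow> measure N (cylinder (coord x) n) \<le> ((1/2) ^ n) powr s'"
  shows "\<exists>n. U \<subseteq> cylinder (coord x) n \<and>
    ennreal (measure N (cylinder (coord x) n)) \<le> ennreal (2 powr s') * diam_pow s U + ennreal \<eta>"
proof -
  define d where "d = diameter U"
  have dist: "dist x y \<le> d" if "y \<in> U" for y
    unfolding d_def using diameter_bounded_bound[OF U(1) U(3) that] .
  have "(1/2::real) ^ m \<le> 1" by (rule power_le_one) auto
  then have d: "0 \<le> d" "d \<le> (1/2) ^ Suc m" "d \<le> 1"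
    using diameter_ge_0[OF U(1)] U(2) by (auto simp: d_def)
  show ?thesis
  proof (cases "d = 0")
    case True
    have "2 powr (- s') < 1" using powr_less_mono[of "- s'" 0 2] s by simp
    then obtain n where n: "n \<ge> m" "1 * (2 powr (- s')) ^ n < \<eta>"
      using ex_geometric_less[of "2 powr (- s')" \<eta> m 1] \<open>0 < \<eta>\<close> s by auto
    have "y \<in> cylinder (coord x) n" if "y \<in> U" for y
      using dist[OF that] True by (auto simp: mem_cylinder_coord_iff)
    moreover have "measure N (cylinder (coord x) n) \<le> \<eta>"
      using dens[OF n(1)] n(2) by (simp add: half_power_powr')
    then have "ennreal (measure N (cylinder (coord x) n)) \<le>
        ennreal (2 powr s') * diam_pow s U + ennreal \<eta>"
      by (intro order.trans[OF ennreal_leI add_increasing]) auto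
    ultimately show ?thesis by blast
  next
    case False
    then have "0 < d" using d by simp
    then obtain n where n: "(1/2) ^ n < d" "d \<le> 2 * (1/2) ^ n"
      using dyadic_bracket d(3) by blast
    have "n \<noteq> 0" using n(1) d(3) by (cases n) auto
    then obtain k where k: "n = Suc k" by (cases n) auto
    have kd: "d \<le> (1/2) ^ k" "(1/2) ^ k < 2 * d" using n by (auto simp: k)
    \<comment> \<open>The extra factor 1/2 in the bound on the diameter puts k beyond m, where
      \<open>dens\<close> applies.\<close>
    have "(1/2::real) ^ k < (1/2) ^ m" using kd(2) d(2) unfolding power_Suc by linarith
    then have "m < k" by (subst (asm) power_strict_decreasing_iff) auto
    have "y \<in> cylinder (coord x) k" if "y \<in> U" for y
      using dist[OF that] kd by (auto simp: mem_cylinder_coord_iff)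
    moreover have "measure N (cylinder (coord x) k) \<le> 2 powr s' * d powr s"
    proof -
      have "measure N (cylinder (coord x) k) \<le> ((1/2) ^ k) powr s'" using dens \<open>m < k\<close> by simp
      also have "\<dots> \<le> (2 * d) powr s'" using kd s by (intro powr_mono2) auto
      also have "\<dots> = 2 powr s' * d powr s'" using d by (simp add: powr_mult)
      also have "d powr s' \<le> d powr s" using s d \<open>0 < d\<close> by (intro powr_mono') auto
      finally show ?thesis by simp
    qed
    moreover have "diam_pow s U = ennreal (d powr s)"
      using U(3) \<open>0 < d\<close> by (auto simp: diam_pow_def d_def)
    ultimately have "U \<subseteq> cylinder (coord x) k \<and> ennreal (measure N (cylinder (coord x) k))
        \<le> ennreal (2 powr s') * diam_pow s U + ennreal \<eta>"
      by (auto simp flip: ennreal_mult intro!: add_increasing2 ennreal_leI)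
    then show ?thesis by blast
  qed
qed

text \<open>Mass distribution principle. Covering sets that meet \<open>A\<close> are enlarged to
  cylinders of controlled mass; these are measurable whatever the cover is, and together they carry
  at least the mass of \<open>A\<close>.\<close>

lemma hausdorff_measure_nonzero:
  fixes E :: "cantor set"
  assumes N: "prob_space N" "sets N = sets borel"
    and A: "A \<in> sets N" "measure N A > 0" "AE x in N. x \<in> A \<longrightarrow> x \<in> E"
    and s: "s < s'" "0 < s'"
    and dens: "\<And>x n. x \<in> A \<Longrightarrow> n \<ge> m \<Longrightarrow> measure N (cylinder (coord x) n) \<le> ((1/2) ^ n) powr s'"
  shows "hausdorff_measure s E \<noteq> 0"
proof
  interpret prob_space N by (rule N)
  assume "hausdorff_measure s E = 0"
  moreover have "hausdorff_pre s ((1/2) ^ Suc m) E \<le> hausdorff_measure s E"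
    unfolding hausdorff_measure_eq_SUP by (rule SUP_upper) simp
  ultimately have 0: "hausdorff_pre s ((1/2) ^ Suc m) E = 0" by simp
  define c where "c = measure N A"
  have "c > 0" using A by (simp add: c_def)
  define K :: real where "K = 2 powr s'"
  have "K > 0" by (simp add: K_def)
  \<comment> \<open>The budget: the cover costs at most K times c/(4K), the errors
    \<open>\<eta> i\<close> add up to c/4, and the total c/2 falls short of c.\<close>
  have "hausdorff_pre s ((1/2) ^ Suc m) E < ennreal (c / (4 * K))"
    unfolding 0 using \<open>c > 0\<close> \<open>K > 0\<close> by simp
  then obtain U where U: "\<And>i. bounded (U i)" "\<And>i. diameter (U i) \<le> (1/2) ^ Suc m" "E \<subseteq> (\<Union>i. U i)"
      "(\<Sum>i. diam_pow s (U i)) < ennreal (c / (4 * K))"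
    unfolding hausdorff_pre_def INF_less_iff by auto
  define \<eta> where "\<eta> = (\<lambda>i::nat. c / 4 * (1/2) ^ Suc i)"
  have ex: "\<exists>V. V \<in> sets N \<and> U i \<inter> A \<subseteq> V \<and> emeasure N V \<le> ennreal K * diam_pow s (U i) + ennreal (\<eta> i)"
    for i
  proof (cases "U i \<inter> A = {}")
    case True
    then show ?thesis by (intro exI[of _ "{}"]) auto
  next
    case False
    then obtain x where x: "x \<in> U i" "x \<in> A" by blast
    have "\<eta> i > 0" using \<open>c > 0\<close> by (simp add: \<eta>_def)
    from cylinder_mass_le_diam_pow[OF s U(1) U(2) x(1) this dens[OF x(2)]]
    obtain n where "U i \<subseteq> cylinder (coord x) n" "ennreal (measure N (cylinder (coord x) n))
        \<le> ennreal K * diam_pow s (U i) + ennreal (\<eta> i)" by (auto simp: K_def)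
    then show ?thesis
      by (intro exI[of _ "cylinder (coord x) n"]) (auto simp: N(2) emeasure_eq_measure)
  qed
  obtain V where V: "\<And>i. V i \<in> sets N" "\<And>i. U i \<inter> A \<subseteq> V i"
      "\<And>i. emeasure N (V i) \<le> ennreal K * diam_pow s (U i) + ennreal (\<eta> i)"
    using ex by metis
  have "ennreal c = emeasure N A" by (simp add: c_def emeasure_eq_measure)
  also have "AE x in N. x \<in> A \<longrightarrow> x \<in> (\<Union>i. V i)"
    using A(3) by eventually_elim (use U(3) V(2) in blast)
  then have "emeasure N A \<le> emeasure N (\<Union>i. V i)"
    using V(1) by (intro emeasure_mono_AE) auto
  also have "\<dots> \<le> (\<Sum>i. emeasure N (V i))"
    using V(1) by (intro emeasure_subadditive_countably) auto
  also have "\<dots> \<le> (\<Sum>i. ennreal K * diam_pow s (U i) + ennreal (\<eta> i))"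
    by (intro suminf_le V(3)) auto
  also have "\<dots> = ennreal K * (\<Sum>i. diam_pow s (U i)) + (\<Sum>i. ennreal (\<eta> i))"
    by (simp add: suminf_add[symmetric])
  also have "(\<Sum>i. ennreal (\<eta> i)) = ennreal (c / 4)"
    unfolding \<eta>_def using \<open>c > 0\<close> by (intro suminf_ennreal_halves) simp
  also have "ennreal K * (\<Sum>i. diam_pow s (U i)) \<le> ennreal K * ennreal (c / (4 * K))"
    using U(4) by (intro mult_left_mono) auto
  also have "\<dots> = ennreal (c / 4)"
    using \<open>K > 0\<close> \<open>c > 0\<close> by (simp flip: ennreal_mult)
  also have "\<dots> + ennreal (c / 4) = ennreal (c / 2)"
    using \<open>c > 0\<close> by (simp flip: ennreal_plus)
  finally show False using \<open>c > 0\<close> by (simp add: add_right_mono)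
qed

text \<open>Choosing one point of \<open>F\<close> in each cylinder of order n that meets
  \<open>F\<close> gives balls that are at once a packing and a centered cover. Lower bounds for
  packing measures use the former, upper bounds for Hausdorff measures the latter.\<close>

lemma cylinder_transversal:
  fixes F :: "cantor set"
  obtains W x where "finite W" "W \<subseteq> words n" "\<And>\<epsilon>. \<epsilon> \<in> W \<Longrightarrow> x \<epsilon> \<in> F \<inter> cylinder \<epsilon> n"
    "F \<subseteq> (\<Union>\<epsilon>\<in>W. cylinder \<epsilon> n)"
    "inj_on x W" "disjoint_family_on (\<lambda>(x, r). ball x r) ((\<lambda>\<epsilon>. (x \<epsilon>, 2 * (1/2) ^ n)) ` W)"
proof -
  define W where "W = {\<epsilon> \<in> words n. F \<inter> cylinder \<epsilon> n \<noteq> {}}"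
  define x where "x = (\<lambda>\<epsilon>. SOME x. x \<in> F \<inter> cylinder \<epsilon> n)"
  have x: "x \<epsilon> \<in> F \<inter> cylinder \<epsilon> n" if "\<epsilon> \<in> W" for \<epsilon>
    unfolding x_def some_in_eq using that by (simp add: W_def)
  have eq: "\<epsilon> = \<epsilon>'" if "\<epsilon> \<in> W" "\<epsilon>' \<in> W" "y \<in> cylinder \<epsilon> n" "y \<in> cylinder \<epsilon>' n" for \<epsilon> \<epsilon>' y
  proof (rule PiE_ext)
    show "\<epsilon> \<in> words n" "\<epsilon>' \<in> words n" using that by (auto simp: W_def)
    show "\<epsilon> j = \<epsilon>' j" if "j \<in> {1..n}" for j
      using \<open>y \<in> cylinder \<epsilon> n\<close> \<open>y \<in> cylinder \<epsilon>' n\<close> that by (auto simp: cylinder_def)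
  qed
  have ball: "ball (x \<epsilon>) (2 * (1/2) ^ n) = cylinder \<epsilon> n" if "\<epsilon> \<in> W" for \<epsilon>
    using cylinder_eq_of_mem[of "x \<epsilon>" \<epsilon> n] x[OF that] by (simp add: ball_eq_cylinder)
  show thesis
  proof
    show "finite W" unfolding W_def using finite_words by (rule finite_subset[rotated]) auto
    show "W \<subseteq> words n" by (auto simp: W_def)
    show "x \<epsilon> \<in> F \<inter> cylinder \<epsilon> n" if "\<epsilon> \<in> W" for \<epsilon> using x[OF that] .
    show "F \<subseteq> (\<Union>\<epsilon>\<in>W. cylinder \<epsilon> n)"
    proof
      fix y assume "y \<in> F"
      moreover have "y \<in> cylinder (restrict (coord y) {1..n}) n" unfolding cylinder_restrict by simp
      moreover have "restrict (coord y) {1..n} \<in> words n" by auto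
      ultimately show "y \<in> (\<Union>\<epsilon>\<in>W. cylinder \<epsilon> n)" unfolding W_def by blast
    qed
    show "inj_on x W"
    proof (rule inj_onI)
      fix \<epsilon> \<epsilon>' assume "\<epsilon> \<in> W" "\<epsilon>' \<in> W" "x \<epsilon> = x \<epsilon>'"
      then show "\<epsilon> = \<epsilon>'" using x[of \<epsilon>] x[of \<epsilon>'] by (intro eq[of \<epsilon> \<epsilon>' "x \<epsilon>"]) auto
    qed
    show "disjoint_family_on (\<lambda>(x, r). ball x r) ((\<lambda>\<epsilon>. (x \<epsilon>, 2 * (1/2) ^ n)) ` W)"
      unfolding disjoint_family_on_def
    proof (intro ballI impI)
      fix a b :: "cantor \<times> real" assume "a \<in> (\<lambda>\<epsilon>. (x \<epsilon>, 2 * (1/2) ^ n)) ` W" "b \<in> (\<lambda>\<epsilon>. (x \<epsilon>, 2 * (1/2) ^ n)) ` W" "a \<noteq> b"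
      then obtain \<epsilon> \<epsilon>' where e: "\<epsilon> \<in> W" "\<epsilon>' \<in> W" "a = (x \<epsilon>, 2 * (1/2) ^ n)" "b = (x \<epsilon>', 2 * (1/2) ^ n)" "\<epsilon> \<noteq> \<epsilon>'"
        by auto
      then show "(case a of (x, r) \<Rightarrow> ball x r) \<inter> (case b of (x, r) \<Rightarrow> ball x r) = {}"
        using eq[OF e(1,2)] by (auto simp only: e prod.case ball)
    qed
  qed
qed

text \<open>Mass distribution for packings. The cylinders of a single order n that meet
  \<open>F i \<inter> A\<close> form a packing and cover this set, so the density bound is asked
  only for infinitely many orders, in contrast to \<open>hausdorff_measure_nonzero\<close>. This is
  what lets the larger of two oscillating averages decide.\<close>

lemma mf_packing_nonzero:
  fixes E :: "cantor set"
  assumes N: "prob_space N" "sets N = sets borel"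
    and A: "A \<in> sets N" "measure N A > 0" "AE x in N. x \<in> A \<longrightarrow> x \<in> E"
    and K: "infinite K" and pos: "\<And>\<epsilon> n. measure \<mu> (cylinder \<epsilon> n) > 0"
    and dens: "\<And>x n. x \<in> A \<Longrightarrow> n \<in> K \<Longrightarrow> measure N (cylinder (coord x) n)
        \<le> (2 * (1/2) ^ n) powr t * measure \<mu> (cylinder (coord x) n) powr q"
  shows "mf_packing \<mu> q t E \<noteq> 0"
proof
  interpret prob_space N by (rule N)
  assume 0: "mf_packing \<mu> q t E = 0"
  define c where "c = measure N A"
  have "c > 0" using A by (simp add: c_def)
  have "mf_packing \<mu> q t E < ennreal (c / 4)"
    unfolding 0 using \<open>c > 0\<close> by simp
  then obtain F where F: "E \<subseteq> (\<Union>i. F i)" "(\<Sum>i. mf_packing_pre \<mu> q t (F i)) < ennreal (c / 4)"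
    unfolding mf_packing_def INF_less_iff by auto
  define \<eta> where "\<eta> = (\<lambda>i::nat. c / 4 * (1/2) ^ Suc i)"
  have ex: "\<exists>V. V \<in> sets N \<and> F i \<inter> A \<subseteq> V \<and> emeasure N V \<le> mf_packing_pre \<mu> q t (F i) + ennreal (\<eta> i)"
    for i
  proof -
    have "mf_packing_pre \<mu> q t (F i) \<le> (\<Sum>i. mf_packing_pre \<mu> q t (F i))"
      using sum_le_suminf[of "\<lambda>i. mf_packing_pre \<mu> q t (F i)" "{i}"] by simp
    then have "mf_packing_pre \<mu> q t (F i) < ennreal (c / 4)" using F(2) by (rule le_less_trans)
    then have "mf_packing_pre \<mu> q t (F i) \<noteq> \<top>" by auto
    moreover have "ennreal (\<eta> i) > 0" using \<open>c > 0\<close> by (simp add: \<eta>_def)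
    \<comment> \<open>Finiteness makes adding \<open>\<eta> i\<close> a strict increase, so the
      infimum over scales is undercut at some \<open>\<delta>\<close>.\<close>
    ultimately have "mf_packing_pre \<mu> q t (F i) < mf_packing_pre \<mu> q t (F i) + ennreal (\<eta> i)"
      using ennreal_add_left_cancel_less[of "mf_packing_pre \<mu> q t (F i)" 0 "ennreal (\<eta> i)"] by simp
    then obtain \<delta> where \<delta>: "\<delta> > 0"
        "mf_packing_pre_delta \<mu> q t \<delta> (F i) < mf_packing_pre \<mu> q t (F i) + ennreal (\<eta> i)"
      by (subst (asm) mf_packing_pre_eq_INF) (auto simp: INF_less_iff)
    obtain n0 where n0: "2 * (1/2) ^ n0 < \<delta>" using ex_geometric_less[of "1/2" \<delta> 0 2] \<delta> by auto
    obtain n where n: "n \<in> K" "n \<ge> n0" using K infinite_nat_iff_unbounded_le by blast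
    have "(1/2::real) ^ n \<le> (1/2) ^ n0" using n by (intro power_decreasing) auto
    then have n\<delta>: "2 * (1/2) ^ n \<le> \<delta>" using n0 by linarith
    obtain W x where W: "finite W" "\<And>\<epsilon>. \<epsilon> \<in> W \<Longrightarrow> x \<epsilon> \<in> (F i \<inter> A) \<inter> cylinder \<epsilon> n"
        "F i \<inter> A \<subseteq> (\<Union>\<epsilon>\<in>W. cylinder \<epsilon> n)" "inj_on x W"
        "disjoint_family_on (\<lambda>(x, r). ball x r) ((\<lambda>\<epsilon>. (x \<epsilon>, 2 * (1/2) ^ n)) ` W)"
      using cylinder_transversal[of n "F i \<inter> A"] by metis
    define \<B> where "\<B> = (\<lambda>\<epsilon>. (x \<epsilon>, 2 * (1/2::real) ^ n)) ` W"
    have pack: "delta_packing \<delta> (F i) \<B>"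
      unfolding delta_packing_def \<B>_def using W(2,5) n\<delta> by auto
    have eq: "cylinder (coord (x \<epsilon>)) n = cylinder \<epsilon> n" if "\<epsilon> \<in> W" for \<epsilon>
      using W(2)[OF that] by (intro cylinder_eq_of_mem) auto
    have inj: "inj_on (\<lambda>\<epsilon>. (x \<epsilon>, 2 * (1/2::real) ^ n)) W"
      using W(4) by (auto simp: inj_on_def)
    have "emeasure N (\<Union>\<epsilon>\<in>W. cylinder \<epsilon> n) \<le> (\<Sum>\<epsilon>\<in>W. emeasure N (cylinder \<epsilon> n))"
      using W(1) by (intro emeasure_subadditive_finite) (auto simp: N)
    also have "\<dots> \<le> (\<Sum>\<epsilon>\<in>W. ennreal ((2 * (1/2) ^ n) powr t * measure \<mu> (ball (x \<epsilon>) (2 * (1/2) ^ n)) powr q))"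
    proof (rule sum_mono)
      fix \<epsilon> assume e: "\<epsilon> \<in> W"
      show "emeasure N (cylinder \<epsilon> n)
          \<le> ennreal ((2 * (1/2) ^ n) powr t * measure \<mu> (ball (x \<epsilon>) (2 * (1/2) ^ n)) powr q)"
        using dens[of "x \<epsilon>" n] W(2)[OF e] n(1)
        by (auto simp only: emeasure_eq_measure ball_eq_cylinder eq[OF e] intro!: ennreal_leI)
    qed
    also have "\<dots> = (\<Sum>(x, r)\<in>\<B>. ennreal (r powr t * measure \<mu> (ball x r) powr q))"
      unfolding \<B>_def by (subst sum.reindex[OF inj]) simp
    also have "\<dots> \<le> mf_sum \<mu> q t \<B>"
    proof (rule sum_le_mf_sum)
      fix y r assume "(y, r) \<in> \<B>"
      then show "measure \<mu> (ball y r) \<noteq> 0"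
        using pos by (auto simp: \<B>_def ball_eq_cylinder less_le)
    qed (auto simp: \<B>_def W)
    also have "\<dots> \<le> mf_packing_pre_delta \<mu> q t \<delta> (F i)"
      unfolding mf_packing_pre_delta_def using pack by (intro SUP_upper) simp
    also note \<delta>(2)
    finally show ?thesis using W(1,3)
      by (intro exI[of _ "\<Union>\<epsilon>\<in>W. cylinder \<epsilon> n"]) (auto simp: N intro!: sets.finite_UN)
  qed
  obtain V where V: "\<And>i. V i \<in> sets N" "\<And>i. F i \<inter> A \<subseteq> V i"
      "\<And>i. emeasure N (V i) \<le> mf_packing_pre \<mu> q t (F i) + ennreal (\<eta> i)"
    using ex by metis
  have "ennreal c = emeasure N A" by (simp add: c_def emeasure_eq_measure)
  also have "AE x in N. x \<in> A \<longrightarrow> x \<in> (\<Union>i. V i)"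
    using A(3) by eventually_elim (use F(1) V(2) in blast)
  then have "emeasure N A \<le> emeasure N (\<Union>i. V i)"
    using V(1) by (intro emeasure_mono_AE) auto
  also have "\<dots> \<le> (\<Sum>i. emeasure N (V i))"
    using V(1) by (intro emeasure_subadditive_countably) auto
  also have "\<dots> \<le> (\<Sum>i. mf_packing_pre \<mu> q t (F i) + ennreal (\<eta> i))"
    by (intro suminf_le V(3)) auto
  also have "\<dots> = (\<Sum>i. mf_packing_pre \<mu> q t (F i)) + (\<Sum>i. ennreal (\<eta> i))"
    by (simp add: suminf_add[symmetric])
  also have "(\<Sum>i. ennreal (\<eta> i)) = ennreal (c / 4)"
    unfolding \<eta>_def using \<open>c > 0\<close> by (intro suminf_ennreal_halves) simp
  also have "(\<Sum>i. mf_packing_pre \<mu> q t (F i)) + ennreal (c / 4) \<le> ennreal (c / 4) + ennreal (c / 4)"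
    using F(2) by (intro add_right_mono) auto
  also have "\<dots> = ennreal (c / 2)"
    using \<open>c > 0\<close> by (simp flip: ennreal_plus)
  finally show False using \<open>c > 0\<close> by simp
qed

section \<open>Upper bounds\<close>

lemma half_power_powr_mult:
  "((1/2::real) ^ n) powr t * 2 powr (a * real n) = (2 powr (a - t)) ^ n"
  unfolding half_power_powr
  by (simp add: powr_realpow[symmetric] powr_powr powr_add[symmetric] algebra_simps)

lemma ennreal_le_zeroI: "(\<And>e. 0 < e \<Longrightarrow> x \<le> ennreal e) \<Longrightarrow> x \<le> 0"
  by (rule ennreal_le_epsilon) simp

text \<open>A centered cover may be uncountable and may list the same ball under many centers and
  radii, whereas \<open>hausdorff_pre\<close> wants a sequence of sets. Keeping one pair per ball
  preserves the union and can only decrease the sum.\<close>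

lemma ex_enumeration_of_cover:
  fixes X :: "cantor set"
  assumes cov: "centered_cover \<delta> X \<B>" and \<delta>: "0 < \<delta>" "\<delta> \<le> 1" and s: "0 < s"
    and pos: "\<And>x r. 0 < r \<Longrightarrow> measure \<mu> (ball x r) > 0"
    and le: "\<And>x r. (x, r) \<in> \<B> \<Longrightarrow> r powr s \<le> r powr t * measure \<mu> (ball x r) powr q"
  shows "\<exists>U. (\<forall>i::nat. bounded (U i) \<and> diameter (U i) \<le> \<delta>) \<and> X \<subseteq> (\<Union>i. U i)
     \<and> (\<Sum>i. diam_pow s (U i)) \<le> mf_sum \<mu> q t \<B>"
proof -
  define \<beta> where "\<beta> = (\<lambda>(x, r). ball (x::cantor) r)"
  have rad: "0 < r" "r \<le> \<delta>" "r \<le> 1" if "(x, r) \<in> \<B>" for x r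
    using cov that \<delta> by (auto simp: centered_cover_def)
  have \<beta>_cyl: "\<exists>n. \<beta> (x, r) = cylinder (coord x) n \<and> (1/2) ^ n < r" if b: "(x, r) \<in> \<B>" for x r
  proof -
    obtain n where "(1/2) ^ n < r" "r \<le> 2 * (1/2) ^ n" using dyadic_bracket rad[OF b] by blast
    then show ?thesis using ball_cantor_eq_cylinder[of n r x] by (auto simp: \<beta>_def)
  qed
  have diam: "bounded (\<beta> b)" "\<beta> b \<noteq> {}" "diameter (\<beta> b) \<le> snd b" if mem: "b \<in> \<B>" for b
  proof -
    obtain x r where b: "b = (x, r)" by (cases b)
    obtain n where n: "\<beta> (x, r) = cylinder (coord x) n" "(1/2) ^ n < r"
      using \<beta>_cyl mem b by blast
    show "bounded (\<beta> b)" by (simp add: \<beta>_def b)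
    show "\<beta> b \<noteq> {}" using n cylinder_nonempty by (simp add: b)
    show "diameter (\<beta> b) \<le> snd b" using n by (simp add: b diameter_cylinder)
  qed
  have "\<beta> ` \<B> \<subseteq> range (\<lambda>(\<epsilon>, n). cylinder \<epsilon> n)"
  proof
    fix S assume "S \<in> \<beta> ` \<B>"
    then obtain x r where "(x, r) \<in> \<B>" "S = \<beta> (x, r)" by auto
    then show "S \<in> range (\<lambda>(\<epsilon>, n). cylinder \<epsilon> n)" using \<beta>_cyl by blast
  qed
  then have "countable (\<beta> ` \<B>)" by (rule countable_subset[OF _ countable_cylinders])
  \<comment> \<open>One representative pair for each ball; balls of the cover are cylinders, hence
    countably many.\<close>
  define C where "C = inv_into \<B> \<beta> ` (\<beta> ` \<B>)"
  have C: "countable C" "C \<subseteq> \<B>" "\<beta> ` C = \<beta> ` \<B>"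
    unfolding C_def
    subgoal using \<open>countable (\<beta> ` \<B>)\<close> by (rule countable_image)
    subgoal by (blast intro: inv_into_into)
    subgoal by (simp add: image_image f_inv_into_f)
    done
  define I where "I = to_nat_on C ` C"
  \<comment> \<open>Indices outside \<open>I\<close> are padded with the empty set, for which
    \<open>diam_pow\<close> is 0 for every exponent.\<close>
  define U where "U = (\<lambda>k. if k \<in> I then \<beta> (from_nat_into C k) else {})"
  have fI: "from_nat_into C k \<in> C" if "k \<in> I" for k
    using that C(1) by (auto simp: I_def)
  have inj: "inj_on (from_nat_into C) I"
    using C(1) by (auto simp: inj_on_def I_def)
  have "bounded (U i) \<and> diameter (U i) \<le> \<delta>" for i
  proof (cases "i \<in> I")
    case True
    then have "from_nat_into C i \<in> \<B>" using fI C(2) by blast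
    moreover from this have "snd (from_nat_into C i) \<le> \<delta>"
      using rad by (cases "from_nat_into C i") auto
    ultimately show ?thesis using diam[of "from_nat_into C i"] True by (auto simp: U_def)
  next
    case False
    then show ?thesis using \<delta> by (auto simp: U_def diameter_def)
  qed
  moreover have "X \<subseteq> (\<Union>i. U i)"
  proof
    fix x assume "x \<in> X"
    then obtain b where "b \<in> \<B>" "x \<in> \<beta> b" using cov by (force simp: centered_cover_def \<beta>_def)
    then obtain c where c: "c \<in> C" "x \<in> \<beta> c" using C(3) by (metis imageE image_eqI)
    then have "x \<in> U (to_nat_on C c)" using C(1) by (auto simp: U_def I_def)
    then show "x \<in> (\<Union>i. U i)" by blast
  qed
  moreover have "(\<Sum>i. diam_pow s (U i)) \<le> mf_sum \<mu> q t \<B>"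
  proof (rule suminf_le_const)
    fix n
    define J where "J = {..<n} \<inter> I"
    have "(\<Sum>i<n. diam_pow s (U i)) = (\<Sum>i\<in>J. diam_pow s (\<beta> (from_nat_into C i)))"
      unfolding J_def by (rule sum.mono_neutral_cong_right) (auto simp: U_def diam_pow_def)
    also have "\<dots> \<le> (\<Sum>i\<in>J. case from_nat_into C i of (x, r) \<Rightarrow>
        ennreal (r powr t * measure \<mu> (ball x r) powr q))"
    proof (rule sum_mono)
      fix i assume "i \<in> J"
      then have i: "from_nat_into C i \<in> \<B>" using fI C(2) by (auto simp: J_def)
      obtain x r where xr: "from_nat_into C i = (x, r)" by (cases "from_nat_into C i")
      have "diam_pow s (\<beta> (x, r)) = ennreal (diameter (\<beta> (x, r)) powr s)"
        using diam[OF i] s by (auto simp: diam_pow_def xr)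
      also have "\<dots> \<le> ennreal (r powr s)"
        using diam[OF i] s by (intro ennreal_leI powr_mono2) (auto simp: xr diameter_ge_0)
      also have "\<dots> \<le> ennreal (r powr t * measure \<mu> (ball x r) powr q)"
        using le i by (intro ennreal_leI) (simp add: xr)
      finally show "diam_pow s (\<beta> (from_nat_into C i)) \<le> (case from_nat_into C i of (x, r) \<Rightarrow>
          ennreal (r powr t * measure \<mu> (ball x r) powr q))" by (simp add: xr)
    qed
    also have "\<dots> = (\<Sum>(x, r)\<in>from_nat_into C ` J. ennreal (r powr t * measure \<mu> (ball x r) powr q))"
      using inj by (subst sum.reindex) (auto simp: J_def inj_on_def)
    also have "\<dots> \<le> mf_sum \<mu> q t \<B>"
    proof (rule sum_le_mf_sum)
      show sub: "from_nat_into C ` J \<subseteq> \<B>" using fI C(2) by (auto simp: J_def)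
      show "measure \<mu> (ball x r) \<noteq> 0" if "(x, r) \<in> from_nat_into C ` J" for x r
        using rad(1) pos sub that by (metis less_irrefl subsetD)
    qed (simp add: J_def)
    finally show "(\<Sum>i<n. diam_pow s (U i)) \<le> mf_sum \<mu> q t \<B>" .
  qed simp
  ultimately show ?thesis by blast
qed

lemma hausdorff_pre_UN_zero:
  fixes X :: "nat \<Rightarrow> 'a::metric_space set"
  assumes "\<And>m. hausdorff_pre s \<delta> (X m) = 0"
  shows "hausdorff_pre s \<delta> (\<Union>m. X m) = 0"
proof -
  have "hausdorff_pre s \<delta> (\<Union>m. X m) \<le> ennreal e" if "0 < e" for e
  proof -
    have "\<exists>U. (\<forall>i. bounded (U i) \<and> diameter (U i) \<le> \<delta>) \<and> X m \<subseteq> (\<Union>i. U i) \<and>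
        (\<Sum>i. diam_pow s (U i)) < ennreal (e * (1/2) ^ Suc m)" for m
    proof -
      have "hausdorff_pre s \<delta> (X m) < ennreal (e * (1/2) ^ Suc m)" using assms that by simp
      then show ?thesis unfolding hausdorff_pre_def INF_less_iff by auto
    qed
    then obtain U where U: "\<And>m i. bounded (U m i) \<and> diameter (U m i) \<le> \<delta>"
        "\<And>m. X m \<subseteq> (\<Union>i. U m i)" "\<And>m. (\<Sum>i. diam_pow s (U m i)) < ennreal (e * (1/2) ^ Suc m)"
      by metis
    define V where "V = (\<lambda>k. case prod_decode k of (m, i) \<Rightarrow> U m i)"
    have "hausdorff_pre s \<delta> (\<Union>m. X m) \<le> (\<Sum>k. diam_pow s (V k))"
      unfolding hausdorff_pre_def
    proof (rule INF_lower, intro CollectI conjI allI)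
      show "bounded (V k)" "diameter (V k) \<le> \<delta>" for k
        using U(1) by (auto simp: V_def split: prod.split)
      show "(\<Union>m. X m) \<subseteq> (\<Union>k. V k)"
      proof
        fix x assume "x \<in> (\<Union>m. X m)"
        then obtain m i where "x \<in> U m i" using U(2) by blast
        then have "x \<in> V (prod_encode (m, i))" by (simp add: V_def)
        then show "x \<in> (\<Union>k. V k)" by blast
      qed
    qed
    also have "\<dots> = (\<Sum>k. (\<lambda>(m, i). diam_pow s (U m i)) (prod_decode k))"
      by (simp add: V_def split_beta)
    also have "\<dots> = (\<Sum>m. \<Sum>i. diam_pow s (U m i))"
      by (rule suminf_ennreal_2dimen) simp
    also have "\<dots> \<le> (\<Sum>m. ennreal (e * (1/2) ^ Suc m))"
      by (intro suminf_le) (use U(3) in \<open>auto intro: less_imp_le\<close>)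
    also have "\<dots> = ennreal e" using that by (intro suminf_ennreal_halves) simp
    finally show ?thesis .
  qed
  then have "hausdorff_pre s \<delta> (\<Union>m. X m) \<le> 0"
    by (rule ennreal_le_zeroI)
  then show ?thesis by simp
qed

text \<open>On the level set \<mu>(B)^q behaves like r^(\<alpha> q), so r^s is below r^t \<mu>(B)^q
  for small r. The index m records from which radius on this holds, making the comparison uniform on
  each piece.\<close>

lemma level_set_subset_UN:
  assumes pos: "\<And>x r. 0 < r \<Longrightarrow> measure \<mu> (ball x r) > 0"
    and s: "t + \<alpha> * q < s"
  shows "level_set \<mu> \<alpha> \<subseteq> (\<Union>m::nat. {x. \<forall>r. 0 < r \<and> r \<le> 1 / real (Suc m) \<longrightarrow>
      r powr s \<le> r powr t * measure \<mu> (ball x r) powr q})"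
proof
  fix x assume "x \<in> level_set \<mu> \<alpha>"
  then have lim: "((\<lambda>r. ln (measure \<mu> (ball x r)) / ln r) \<longlongrightarrow> \<alpha>) (at_right 0)"
    by (simp add: level_set_def)
  have "((\<lambda>r. t + ln (measure \<mu> (ball x r)) / ln r * q) \<longlongrightarrow> t + \<alpha> * q) (at_right 0)"
    by (intro tendsto_intros lim)
  then have "\<forall>\<^sub>F r in at_right 0. t + ln (measure \<mu> (ball x r)) / ln r * q < s"
    using s by (rule order_tendstoD)
  then obtain d where d: "d > 0"
      "\<And>r. 0 < r \<Longrightarrow> r < d \<Longrightarrow> t + ln (measure \<mu> (ball x r)) / ln r * q < s"
    unfolding eventually_at_right_field by auto
  \<comment> \<open>The bound by 1 makes \<open>ln r\<close> negative, so multiplying by it reverses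
    the inequality for the exponents.\<close>
  obtain m where m: "inverse (real (Suc m)) < min d 1" using reals_Archimedean[of "min d 1"] d by auto
  have "r powr s \<le> r powr t * measure \<mu> (ball x r) powr q"
    if r: "0 < r" "r \<le> 1 / real (Suc m)" for r
  proof -
    have r1: "r < d" "r < 1" using r(2) m unfolding inverse_eq_divide by linarith+
    have M: "measure \<mu> (ball x r) > 0" using pos r by simp
    have ln: "ln r < 0" using r r1 by simp
    define v where "v = ln (measure \<mu> (ball x r)) / ln r"
    have v: "ln (measure \<mu> (ball x r)) = v * ln r" using ln by (simp add: v_def)
    have "s * ln r \<le> (t + v * q) * ln r"
      using d(2)[OF r(1) r1(1)] ln unfolding v_def[symmetric] by (intro mult_right_mono_neg) auto
    also have "\<dots> = t * ln r + q * ln (measure \<mu> (ball x r))" by (simp add: v algebra_simps)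
    finally have "exp (s * ln r) \<le> exp (t * ln r) * exp (q * ln (measure \<mu> (ball x r)))"
      by (simp flip: exp_add)
    then show ?thesis using r M by (simp add: powr_def)
  qed
  then show "x \<in> (\<Union>m::nat. {x. \<forall>r. 0 < r \<and> r \<le> 1 / real (Suc m) \<longrightarrow>
      r powr s \<le> r powr t * measure \<mu> (ball x r) powr q})" by blast
qed

text \<open>This is the bound of the Hausdorff dimension by b(q) + \<alpha> q. Covers of
  \<open>X m\<close> have their centers in \<open>X m\<close>, so each term r^s is dominated by the
  multifractal one.\<close>

lemma hausdorff_measure_level_set_zero:
  fixes \<mu> :: "cantor measure"
  assumes pos: "\<And>x r. 0 < r \<Longrightarrow> measure \<mu> (ball x r) > 0"
    and 0: "mf_hausdorff \<mu> q t UNIV = 0" and s: "0 < s" "t + \<alpha> * q < s"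
  shows "hausdorff_measure s (level_set \<mu> \<alpha>) = 0"
proof -
  define X where "X = (\<lambda>m::nat. {x. \<forall>r. 0 < r \<and> r \<le> 1 / real (Suc m) \<longrightarrow>
      r powr s \<le> r powr t * measure \<mu> (ball x r) powr q})"
  have sub: "level_set \<mu> \<alpha> \<subseteq> (\<Union>m. X m)"
    unfolding X_def by (rule level_set_subset_UN[OF pos s(2)])
  have "hausdorff_pre s \<delta> (X m) = 0" if "\<delta> > 0" for \<delta> m
  proof -
    define \<delta>' where "\<delta>' = min \<delta> (1 / real (Suc m))"
    have \<delta>': "0 < \<delta>'" "\<delta>' \<le> \<delta>" "\<delta>' \<le> 1 / real (Suc m)" "\<delta>' \<le> 1"
      using that by (auto simp: \<delta>'_def min_le_iff_disj)
    have "mf_hausdorff_pre_delta \<mu> q t \<delta>' (X m) \<le> mf_hausdorff_pre \<mu> q t (X m)"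
      unfolding mf_hausdorff_pre_eq_SUP using \<delta>' by (intro SUP_upper) simp
    \<comment> \<open>The supremum over subsets in \<open>mf_hausdorff\<close> allows passing to the
      piece \<open>X m\<close>.\<close>
    also have "\<dots> \<le> mf_hausdorff \<mu> q t UNIV"
      unfolding mf_hausdorff_def by (intro SUP_upper) simp
    finally have z: "mf_hausdorff_pre_delta \<mu> q t \<delta>' (X m) = 0" using 0 by simp
    have "hausdorff_pre s \<delta> (X m) \<le> ennreal e" if "0 < e" for e
    proof -
      have "mf_hausdorff_pre_delta \<mu> q t \<delta>' (X m) < ennreal e" using that z by simp
      then obtain \<B> where \<B>: "centered_cover \<delta>' (X m) \<B>" "mf_sum \<mu> q t \<B> < ennreal e"
        unfolding mf_hausdorff_pre_delta_def INF_less_iff by auto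
      have "r powr s \<le> r powr t * measure \<mu> (ball x r) powr q" if "(x, r) \<in> \<B>" for x r
      proof -
        have "x \<in> X m" "0 < r" "r \<le> \<delta>'" using \<B>(1) that by (auto simp: centered_cover_def)
        then show ?thesis using \<delta>'(3) unfolding X_def by auto
      qed
      from ex_enumeration_of_cover[OF \<B>(1) \<delta>'(1,4) s(1) pos this]
      obtain U where U: "\<And>i::nat. bounded (U i) \<and> diameter (U i) \<le> \<delta>'" "X m \<subseteq> (\<Union>i. U i)"
          "(\<Sum>i. diam_pow s (U i)) \<le> mf_sum \<mu> q t \<B>" by blast
      have "hausdorff_pre s \<delta> (X m) \<le> (\<Sum>i. diam_pow s (U i))"
        unfolding hausdorff_pre_def using U(1,2) \<delta>'(2) by (intro INF_lower) (auto intro: order_trans)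
      also note U(3)
      also note less_imp_le[OF \<B>(2)]
      finally show ?thesis .
    qed
    then have "hausdorff_pre s \<delta> (X m) \<le> 0" by (rule ennreal_le_zeroI)
    then show ?thesis by simp
  qed
  then have z: "hausdorff_pre s \<delta> (\<Union>m. X m) = 0" if "\<delta> > 0" for \<delta>
    using that by (intro hausdorff_pre_UN_zero) auto
  have "hausdorff_pre s \<delta> (level_set \<mu> \<alpha>) \<le> 0" if "\<delta> > 0" for \<delta>
    unfolding z[OF that, symmetric] hausdorff_pre_def
    by (rule INF_superset_mono) (use sub in auto)
  then have "hausdorff_measure s (level_set \<mu> \<alpha>) \<le> 0"
    unfolding hausdorff_measure_eq_SUP by (intro SUP_least) auto
  then show ?thesis by simp
qed

text \<open>This is the bound of the packing dimension by B(q) + \<alpha> q. The comparison is made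
  at an exponent \<open>s0\<close> strictly below \<open>s\<close>: a premeasure below 1 then gives
  the bound \<delta>^(s - s0), which tends to 0.\<close>

lemma packing_measure_level_set_zero:
  fixes \<mu> :: "'a::metric_space measure"
  assumes pos: "\<And>x r. 0 < r \<Longrightarrow> measure \<mu> (ball x r) > 0"
    and 0: "mf_packing \<mu> q t UNIV = 0" and s: "t + \<alpha> * q < s"
  shows "packing_measure s (level_set \<mu> \<alpha>) = 0"
proof -
  obtain s0 where s0: "t + \<alpha> * q < s0" "s0 < s" using s dense by blast
  define X where "X = (\<lambda>m::nat. {x. \<forall>r. 0 < r \<and> r \<le> 1 / real (Suc m) \<longrightarrow>
      r powr s0 \<le> r powr t * measure \<mu> (ball x r) powr q})"
  have sub: "level_set \<mu> \<alpha> \<subseteq> (\<Union>m. X m)"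
    unfolding X_def by (rule level_set_subset_UN[OF pos s0(1)])
  have "mf_packing \<mu> q t UNIV < 1" using 0 by simp
  then obtain F where F: "UNIV = (\<Union>i. F i)" "(\<Sum>i. mf_packing_pre \<mu> q t (F i)) < 1"
    unfolding mf_packing_def INF_less_iff by auto
  have z: "packing_pre s (F i \<inter> X m) = 0" for i m
  proof -
    have "mf_packing_pre \<mu> q t (F i) \<le> (\<Sum>i. mf_packing_pre \<mu> q t (F i))"
      using sum_le_suminf[of "\<lambda>i. mf_packing_pre \<mu> q t (F i)" "{i}"] by simp
    then have "mf_packing_pre \<mu> q t (F i) < 1" using F(2) by (rule le_less_trans)
    then obtain \<delta>0 where \<delta>0: "\<delta>0 > 0" "mf_packing_pre_delta \<mu> q t \<delta>0 (F i) < 1"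
      unfolding mf_packing_pre_eq_INF INF_less_iff by auto
    have bound: "packing_pre_delta s \<delta> (F i \<inter> X m) \<le> ennreal (\<delta> powr (s - s0))"
      if \<delta>: "0 < \<delta>" "\<delta> \<le> \<delta>0" "\<delta> \<le> 1 / real (Suc m)" for \<delta>
      unfolding packing_pre_delta_def
    proof (rule SUP_least)
      fix \<B> assume "\<B> \<in> {\<B>. delta_packing \<delta> (F i \<inter> X m) \<B>}"
      then have pk: "delta_packing \<delta> (F i \<inter> X m) \<B>" by simp
      then have pk': "delta_packing \<delta>0 (F i) \<B>" using \<delta>(2) by (force simp: delta_packing_def)
      show "(\<Sum>\<^sub>\<infinity>(x, r)\<in>\<B>. ennreal (r powr s)) \<le> ennreal (\<delta> powr (s - s0))"
      proof (subst nonneg_infsum_complete, simp, rule SUP_least)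
        fix G assume "G \<in> {G. finite G \<and> G \<subseteq> \<B>}"
        then have G: "finite G" "G \<subseteq> \<B>" by auto
        have xr: "x \<in> X m" "0 < r" "r \<le> \<delta>" if "(x, r) \<in> G" for x r
          using pk that G(2) by (auto simp: delta_packing_def)
        have "(\<Sum>(x, r)\<in>G. ennreal (r powr s)) \<le>
            (\<Sum>(x, r)\<in>G. ennreal (\<delta> powr (s - s0)) * ennreal (r powr t * measure \<mu> (ball x r) powr q))"
        proof (rule sum_mono, clarify)
          fix x r assume "(x, r) \<in> G"
          note xr = xr[OF this]
          have "r powr s = r powr (s - s0) * r powr s0" by (simp flip: powr_add)
          also have "\<dots> \<le> \<delta> powr (s - s0) * (r powr t * measure \<mu> (ball x r) powr q)"
            using xr \<delta> s0 by (intro mult_mono powr_mono2) (auto simp: X_def)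
          finally show "ennreal (r powr s)
              \<le> ennreal (\<delta> powr (s - s0)) * ennreal (r powr t * measure \<mu> (ball x r) powr q)"
            by (simp flip: ennreal_mult)
        qed
        also have "\<dots> = ennreal (\<delta> powr (s - s0)) *
            (\<Sum>(x, r)\<in>G. ennreal (r powr t * measure \<mu> (ball x r) powr q))"
          unfolding sum_distrib_left split_beta ..
        also have "\<dots> \<le> ennreal (\<delta> powr (s - s0)) * mf_sum \<mu> q t \<B>"
          using G xr(2) pos by (intro mult_left_mono sum_le_mf_sum) (auto simp: less_le)
        also have "\<dots> \<le> ennreal (\<delta> powr (s - s0)) * mf_packing_pre_delta \<mu> q t \<delta>0 (F i)"
          unfolding mf_packing_pre_delta_def using pk' by (intro mult_left_mono SUP_upper) auto
        also have "\<dots> \<le> ennreal (\<delta> powr (s - s0)) * 1"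
          using \<delta>0(2) by (intro mult_left_mono) auto
        finally show "(\<Sum>(x, r)\<in>G. ennreal (r powr s)) \<le> ennreal (\<delta> powr (s - s0))" by simp
      qed
    qed
    have "packing_pre s (F i \<inter> X m) \<le> ennreal e" if "e > 0" for e
    proof -
      \<comment> \<open>The first entry is the scale at which \<delta>^(s - s0) equals e.\<close>
      define \<delta> where "\<delta> = min (e powr (1 / (s - s0))) (min \<delta>0 (1 / real (Suc m)))"
      have \<delta>: "0 < \<delta>" "\<delta> \<le> \<delta>0" "\<delta> \<le> 1 / real (Suc m)" "\<delta> \<le> e powr (1 / (s - s0))"
        using that \<delta>0 by (auto simp: \<delta>_def min_le_iff_disj)
      have "packing_pre s (F i \<inter> X m) \<le> packing_pre_delta s \<delta> (F i \<inter> X m)"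
        unfolding packing_pre_eq_INF using \<delta> by (intro INF_lower) simp
      also have "\<dots> \<le> ennreal (\<delta> powr (s - s0))" by (rule bound[OF \<delta>(1-3)])
      also have "\<delta> powr (s - s0) \<le> (e powr (1 / (s - s0))) powr (s - s0)"
        using \<delta> s0 by (intro powr_mono2) auto
      also have "\<dots> = e" using that s0 by (simp add: powr_powr)
      finally show ?thesis by (simp add: ennreal_leI)
    qed
    then have "packing_pre s (F i \<inter> X m) \<le> 0" by (rule ennreal_le_zeroI)
    then show ?thesis by simp
  qed
  define G where "G = (\<lambda>k. case prod_decode k of (i, m) \<Rightarrow> F i \<inter> X m)"
  have "level_set \<mu> \<alpha> \<subseteq> (\<Union>k. G k)"
  proof
    fix x assume "x \<in> level_set \<mu> \<alpha>"
    then obtain i m where "x \<in> F i \<inter> X m" using sub F(1) by blast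
    then have "x \<in> G (prod_encode (i, m))" by (simp add: G_def)
    then show "x \<in> (\<Union>k. G k)" by blast
  qed
  then have "packing_measure s (level_set \<mu> \<alpha>) \<le> (\<Sum>k. packing_pre s (G k))"
    unfolding packing_measure_def by (intro INF_lower) simp
  moreover have "packing_pre s (G k) = 0" for k
    unfolding G_def using z by (simp split: prod.split)
  ultimately show ?thesis by simp
qed

text \<open>Cylinders of one common order n give a centered cover with sum at most 2^t 2^((a - t)
  n). One good order below each scale is enough, so the partition sums are controlled only along
  \<open>K\<close>.\<close>

lemma mf_hausdorff_zero:
  fixes \<mu> :: "cantor measure"
  assumes K: "infinite K" and a: "a < t"
    and Z: "\<And>n. n \<in> K \<Longrightarrow> (\<Sum>\<epsilon>\<in>words n. measure \<mu> (cylinder \<epsilon> n) powr q) \<le> 2 powr (a * real n)"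
  shows "mf_hausdorff \<mu> q t UNIV = 0"
proof -
  have "mf_hausdorff_pre_delta \<mu> q t \<delta> F \<le> ennreal e" if \<delta>: "\<delta> > 0" and e: "e > 0" for \<delta> F e
  proof -
    define \<rho> :: real where "\<rho> = 2 powr (a - t)"
    have \<rho>: "0 \<le> \<rho>" "\<rho> < 1" using a powr_less_mono[of "a - t" 0 2] by (auto simp: \<rho>_def)
    obtain n1 where n1: "2 * (1/2) ^ n1 < \<delta>" using ex_geometric_less[of "1/2" \<delta> 0 2] \<delta> by auto
    have "(\<lambda>n. 2 powr t * \<rho> ^ n) \<longlonglongrightarrow> 2 powr t * 0"
      using \<rho> by (intro tendsto_intros) auto
    then have "\<forall>\<^sub>F n in sequentially. 2 powr t * \<rho> ^ n < e"
      by (rule order_tendstoD) (use e in simp)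
    then obtain n2 where n2: "\<And>n. n \<ge> n2 \<Longrightarrow> 2 powr t * \<rho> ^ n < e"
      by (auto simp: eventually_sequentially)
    obtain n where n: "n \<in> K" "n \<ge> max n1 n2" using K infinite_nat_iff_unbounded_le by blast
    have "(1/2::real) ^ n \<le> (1/2) ^ n1" using n by (intro power_decreasing) auto
    then have n\<delta>: "2 * (1/2) ^ n \<le> \<delta>" using n1 by linarith
    obtain W x where W: "finite W" "W \<subseteq> words n" "\<And>\<epsilon>. \<epsilon> \<in> W \<Longrightarrow> x \<epsilon> \<in> F \<inter> cylinder \<epsilon> n"
        "F \<subseteq> (\<Union>\<epsilon>\<in>W. cylinder \<epsilon> n)" "inj_on x W"
      using cylinder_transversal[of n F] by metis
    define \<B> where "\<B> = (\<lambda>\<epsilon>. (x \<epsilon>, 2 * (1/2::real) ^ n)) ` W"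
    have eq: "ball (x \<epsilon>) (2 * (1/2) ^ n) = cylinder \<epsilon> n" if "\<epsilon> \<in> W" for \<epsilon>
      unfolding ball_eq_cylinder using W(3)[OF that] by (intro cylinder_eq_of_mem) auto
    have inj: "inj_on (\<lambda>\<epsilon>. (x \<epsilon>, 2 * (1/2::real) ^ n)) W"
      using W(5) by (auto simp: inj_on_def)
    have "centered_cover \<delta> F \<B>"
      unfolding centered_cover_def \<B>_def using W(3,4) n\<delta> eq by auto
    then have "mf_hausdorff_pre_delta \<mu> q t \<delta> F \<le> mf_sum \<mu> q t \<B>"
      unfolding mf_hausdorff_pre_delta_def by (intro INF_lower) simp
    also have "\<dots> \<le> (\<Sum>(x, r)\<in>\<B>. ennreal (r powr t * measure \<mu> (ball x r) powr q))"
      by (rule mf_sum_leI, rule sum_mono2) (auto simp: \<B>_def W)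
    also have "\<dots> = (\<Sum>\<epsilon>\<in>W. ennreal ((2 * (1/2) ^ n) powr t * measure \<mu> (cylinder \<epsilon> n) powr q))"
      unfolding \<B>_def by (subst sum.reindex[OF inj]) (auto simp: eq intro!: sum.cong)
    also have "\<dots> \<le> (\<Sum>\<epsilon>\<in>words n. ennreal ((2 * (1/2) ^ n) powr t * measure \<mu> (cylinder \<epsilon> n) powr q))"
      using W(2) finite_words by (intro sum_mono2) auto
    also have "\<dots> = ennreal ((2 * (1/2) ^ n) powr t * (\<Sum>\<epsilon>\<in>words n. measure \<mu> (cylinder \<epsilon> n) powr q))"
      by (simp add: sum_ennreal sum_distrib_left)
    also have "\<dots> \<le> ennreal ((2 * (1/2) ^ n) powr t * 2 powr (a * real n))"
      using Z[OF n(1)] by (intro ennreal_leI mult_left_mono) auto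
    also have "(2 * (1/2) ^ n) powr t * 2 powr (a * real n) = 2 powr t * \<rho> ^ n"
      unfolding \<rho>_def half_power_powr_mult[symmetric] by (simp add: powr_mult)
    also have "ennreal (2 powr t * \<rho> ^ n) \<le> ennreal e" using n2[of n] n by (intro ennreal_leI) auto
    finally show ?thesis .
  qed
  then have "mf_hausdorff_pre_delta \<mu> q t \<delta> F \<le> 0" if "\<delta> > 0" for \<delta> F
    by (rule ennreal_le_zeroI) (use that in auto)
  then have "mf_hausdorff_pre \<mu> q t F \<le> 0" for F
    unfolding mf_hausdorff_pre_eq_SUP by (intro SUP_least) auto
  then have "mf_hausdorff \<mu> q t UNIV \<le> 0"
    unfolding mf_hausdorff_def by (intro SUP_least) auto
  then show ?thesis by simp
qed

text \<open>A packing mixes scales, so partition sums of all orders enter. Sorted by order, its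
  balls are distinct cylinders, and summing over all orders from M on gives the tail of a geometric
  series.\<close>

lemma mf_packing_zero:
  fixes \<mu> :: "cantor measure"
  assumes a: "a < t"
    and Z: "\<And>n. (\<Sum>\<epsilon>\<in>words n. measure \<mu> (cylinder \<epsilon> n) powr q) \<le> 2 powr (a * real n)"
  shows "mf_packing \<mu> q t UNIV = 0"
proof -
  define \<rho> :: real where "\<rho> = 2 powr (a - t)"
  have \<rho>: "0 < \<rho>" "\<rho> < 1" using a powr_less_mono[of "a - t" 0 2] by (auto simp: \<rho>_def)
  \<comment> \<open>Compares r^t with 2^(- n t) for radii between 2^-n and 2^(1 - n); the factor 2^t
    is for t \<ge> 0, the factor 1 for t < 0.\<close>
  define C :: real where "C = max 1 (2 powr t)"
  have "C > 0" by (simp add: C_def)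
  have rC: "r powr t \<le> C * ((1/2) ^ n) powr t" if "(1/2) ^ n < r" "r \<le> 2 * (1/2) ^ n" for r n
  proof (cases "t \<ge> 0")
    case True
    have "0 < r" using that(1) by (rule less_trans[rotated]) simp
    have "r powr t \<le> (2 * (1/2) ^ n) powr t" using that True \<open>0 < r\<close> by (intro powr_mono2) auto
    also have "\<dots> = 2 powr t * ((1/2) ^ n) powr t" by (simp add: powr_mult)
    also have "\<dots> \<le> C * ((1/2) ^ n) powr t" by (intro mult_right_mono) (auto simp: C_def)
    finally show ?thesis .
  next
    case False
    have "r powr t \<le> ((1/2) ^ n) powr t" using that False by (intro powr_mono2') auto
    also have "\<dots> \<le> C * ((1/2) ^ n) powr t" by (simp add: C_def mult_le_cancel_right1)
    finally show ?thesis .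
  qed
  have bound: "mf_packing_pre_delta \<mu> q t ((1/2) ^ M) UNIV \<le> ennreal (C / (1 - \<rho>) * \<rho> ^ M)" for M
    unfolding mf_packing_pre_delta_def
  proof (intro SUP_least mf_sum_leI)
    fix \<B> F assume "\<B> \<in> {\<B>. delta_packing ((1/2) ^ M) (UNIV :: cantor set) \<B>}" and F: "finite F" "F \<subseteq> \<B>"
    then have pk: "delta_packing ((1/2) ^ M) (UNIV :: cantor set) \<B>" by simp
    have "\<exists>n. (1/2) ^ n < r \<and> r \<le> 2 * (1/2) ^ n \<and> M \<le> n" if "(x, r) \<in> F" for x r
    proof -
      have r: "0 < r" "r \<le> (1/2) ^ M" using pk that F by (auto simp: delta_packing_def)
      moreover have "(1/2::real) ^ M \<le> 1" by (rule power_le_one) auto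
      ultimately have "r \<le> 1" by linarith
      then obtain n where n: "(1/2) ^ n < r" "r \<le> 2 * (1/2) ^ n"
        using dyadic_bracket[OF r(1)] by blast
      have "(1/2::real) ^ n < (1/2) ^ M" using n r by linarith
      then have "M < n" by (subst (asm) power_strict_decreasing_iff) auto
      then show ?thesis using n by auto
    qed
    then have "\<forall>b\<in>F. \<exists>n. (1/2) ^ n < snd b \<and> snd b \<le> 2 * (1/2) ^ n \<and> M \<le> n" by auto
    then obtain k where "\<forall>b\<in>F. (1/2) ^ k b < snd b \<and> snd b \<le> 2 * (1/2) ^ k b \<and> M \<le> k b"
      by (rule bchoice[THEN exE])
    then have k: "\<And>x r. (x, r) \<in> F \<Longrightarrow> (1/2) ^ k (x, r) < r"
        "\<And>x r. (x, r) \<in> F \<Longrightarrow> r \<le> 2 * (1/2) ^ k (x, r)" "\<And>b. b \<in> F \<Longrightarrow> M \<le> k b"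
      by force+
    \<comment> \<open>A ball is recorded as order and word of its cylinder. Distinct balls of a
      packing are disjoint and nonempty, so their keys differ.\<close>
    define key where "key = (\<lambda>b. (k b, restrict (coord (fst b)) {1..k b}))"
    have ball: "ball x r = cylinder (snd (key (x, r))) (fst (key (x, r)))" if "(x, r) \<in> F" for x r
      using ball_cantor_eq_cylinder[OF k(1,2)[OF that]] by (simp add: key_def cylinder_restrict del: One_nat_def)
    have inj: "inj_on key F"
    proof (rule inj_onI, rule ccontr)
      fix b b' assume b: "b \<in> F" "b' \<in> F" "key b = key b'" "b \<noteq> b'"
      obtain x r x' r' where xr: "b = (x, r)" "b' = (x', r')" by (metis surj_pair)
      have "disjoint_family_on (\<lambda>(x, r). ball x r) \<B>" using pk by (simp add: delta_packing_def)
      from disjoint_family_onD[OF this, of b b'] have "ball x r \<inter> ball x' r' = {}"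
        using F(2) b by (auto simp only: xr prod.case)
      moreover have "ball x r = ball x' r'" using ball b by (simp add: xr)
      moreover have "ball x r \<noteq> {}" using ball[of x r] cylinder_nonempty b by (simp add: xr)
      ultimately show False by simp
    qed
    \<comment> \<open>Inserting M keeps the range of orders nonempty even for empty
      \<open>F\<close>.\<close>
    define L where "L = Max (insert M (k ` F))"
    have "k b \<le> L" if "b \<in> F" for b using that F by (auto simp: L_def)
    then have keyL: "key ` F \<subseteq> Sigma {M..L} words" using k(3) by (auto simp: key_def)
    have "(\<Sum>(x, r)\<in>F. ennreal (r powr t * measure \<mu> (ball x r) powr q)) =
        ennreal (\<Sum>(x, r)\<in>F. r powr t * measure \<mu> (ball x r) powr q)"
      by (subst sum_ennreal[symmetric]) (auto simp: split_beta)
    also have "(\<Sum>(x, r)\<in>F. r powr t * measure \<mu> (ball x r) powr q) \<le>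
        (\<Sum>b\<in>F. case key b of (n, \<epsilon>) \<Rightarrow> C * ((1/2) ^ n) powr t * measure \<mu> (cylinder \<epsilon> n) powr q)"
    proof (rule sum_mono, clarify)
      fix x r assume b: "(x, r) \<in> F"
      have "r powr t \<le> C * ((1/2) ^ fst (key (x, r))) powr t"
        using rC[OF k(1,2)[OF b]] by (simp add: key_def)
      then show "r powr t * measure \<mu> (ball x r) powr q \<le> (case key (x, r) of (n, \<epsilon>) \<Rightarrow>
          C * ((1/2) ^ n) powr t * measure \<mu> (cylinder \<epsilon> n) powr q)"
        unfolding ball[OF b] split_beta by (intro mult_right_mono) auto
    qed
    also have "\<dots> = (\<Sum>(n, \<epsilon>)\<in>key ` F. C * ((1/2) ^ n) powr t * measure \<mu> (cylinder \<epsilon> n) powr q)"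
      by (subst sum.reindex[OF inj]) simp
    also have "\<dots> \<le> (\<Sum>(n, \<epsilon>)\<in>Sigma {M..L} words. C * ((1/2) ^ n) powr t * measure \<mu> (cylinder \<epsilon> n) powr q)"
      using keyL \<open>C > 0\<close> by (intro sum_mono2) (auto intro!: finite_SigmaI finite_PiE)
    also have "\<dots> = (\<Sum>n=M..L. C * ((1/2) ^ n) powr t * (\<Sum>\<epsilon>\<in>words n. measure \<mu> (cylinder \<epsilon> n) powr q))"
      by (subst sum.Sigma[symmetric]) (auto simp: sum_distrib_left intro!: finite_PiE)
    also have "\<dots> \<le> (\<Sum>n=M..L. C * ((1/2) ^ n) powr t * 2 powr (a * real n))"
      using Z \<open>C > 0\<close> by (intro sum_mono mult_left_mono) auto
    also have "\<dots> = (\<Sum>n=M..L. C * \<rho> ^ n)"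
      unfolding \<rho>_def half_power_powr_mult[symmetric] by (simp only: mult.assoc)
    also have "\<dots> = C * (\<Sum>n=M..L. \<rho> ^ n)" by (simp add: sum_distrib_left)
    also have "(\<Sum>n=M..L. \<rho> ^ n) \<le> \<rho> ^ M / (1 - \<rho>)"
    proof -
      have "M \<le> L" using F by (simp add: L_def)
      then have "(\<Sum>n=M..L. \<rho> ^ n) = (\<rho> ^ M - \<rho> ^ Suc L) / (1 - \<rho>)"
        using \<rho> by (subst sum_gp) auto
      also have "\<dots> \<le> \<rho> ^ M / (1 - \<rho>)" using \<rho> by (intro divide_right_mono) auto
      finally show ?thesis .
    qed
    finally show "(\<Sum>(x, r)\<in>F. ennreal (r powr t * measure \<mu> (ball x r) powr q))
        \<le> ennreal (C / (1 - \<rho>) * \<rho> ^ M)"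
      using \<open>C > 0\<close> by (simp add: ennreal_leI)
  qed
  have "mf_packing_pre \<mu> q t UNIV \<le> ennreal e" if e: "e > 0" for e
  proof -
    obtain M where M: "C / (1 - \<rho>) * \<rho> ^ M < e"
      using ex_geometric_less[of \<rho> e 0 "C / (1 - \<rho>)"] \<rho> e by auto
    have "mf_packing_pre \<mu> q t UNIV \<le> mf_packing_pre_delta \<mu> q t ((1/2) ^ M) UNIV"
      unfolding mf_packing_pre_eq_INF by (rule INF_lower) simp
    also note bound[of M]
    also have "ennreal (C / (1 - \<rho>) * \<rho> ^ M) \<le> ennreal e" using M by (intro ennreal_leI) simp
    finally show ?thesis .
  qed
  then have "mf_packing_pre \<mu> q t UNIV \<le> 0" by (rule ennreal_le_zeroI)
  then have "mf_packing_pre \<mu> q t UNIV = 0" by simp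
  moreover have "mf_packing \<mu> q t UNIV \<le> (\<Sum>i::nat. mf_packing_pre \<mu> q t UNIV)"
    unfolding mf_packing_def by (rule INF_lower) simp
  ultimately show ?thesis by simp
qed

section \<open>Biased coins\<close>

text \<open>\<open>True\<close> is the symbol 1, so \<open>u\<close> is the weight of the symbol
  0.\<close>

definition coin :: "real \<Rightarrow> bool \<Rightarrow> real" where
  "coin u e = (if e then 1 - u else u)"

text \<open>The L^q spectrum of the Bernoulli measure with weights u and 1 - u: its partition sum
  over words of length n is 2^(n theta).\<close>

definition theta :: "real \<Rightarrow> real \<Rightarrow> real" where
  "theta u q = log 2 (u powr q + (1 - u) powr q)"

definition gibbs :: "real \<Rightarrow> real \<Rightarrow> bool \<Rightarrow> real" where
  "gibbs u q e = coin u e powr q / (u powr q + (1 - u) powr q)"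

text \<open>The typical local dimension of the u-Bernoulli measure under the Gibbs weights; by
  \<open>theta_has_derivative\<close> it is minus the slope of \<open>theta\<close>.\<close>

definition gibbs_mean :: "real \<Rightarrow> real \<Rightarrow> real" where
  "gibbs_mean u q = - (gibbs u q True * log 2 (1 - u) + gibbs u q False * log 2 u)"

context
  fixes u :: real
  assumes u: "0 < u" "u < 1"
begin

lemma coin_pos: "0 < coin u e"
  using u by (simp add: coin_def)

lemma partition_pos: "0 < u powr q + (1 - u) powr q"
  using u by (intro add_pos_pos) auto

lemma powr_theta: "2 powr theta u q = u powr q + (1 - u) powr q"
  using partition_pos[of q] by (simp add: theta_def)

lemma gibbs_pos: "0 < gibbs u q e"
  unfolding gibbs_def using coin_pos[of e] by (intro divide_pos_pos partition_pos) simp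

lemma gibbs_sum: "gibbs u q True + gibbs u q False = 1"
  using partition_pos[of q] by (simp add: gibbs_def coin_def add_divide_distrib[symmetric] add.commute)

lemma gibbs_eq: "gibbs u q e = coin u e powr q * 2 powr (- theta u q)"
  unfolding gibbs_def powr_minus powr_theta by (simp add: divide_inverse)

lemma log_gibbs: "log 2 (gibbs u q e) = q * log 2 (coin u e) - theta u q"
  using coin_pos[of e] by (simp add: gibbs_eq log_mult log_powr)

text \<open>The Legendre expression is the entropy of the Gibbs weights: average
  \<open>log_gibbs\<close> over both symbols.\<close>

lemma theta_plus_mean_eq_entropy:
  "theta u q + gibbs_mean u q * q
    = gibbs u q True * - log 2 (gibbs u q True) + gibbs u q False * - log 2 (gibbs u q False)"
proof -
  have eq: "gibbs u q True = 1 - gibbs u q False" using gibbs_sum[of q] by simp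
  show ?thesis
    unfolding log_gibbs gibbs_mean_def unfolding eq by (simp add: coin_def algebra_simps)
qed

text \<open>A coin with two positive weights has positive entropy. Positivity matters because the
  dimensions are infima over \<open>0 \<le> s\<close> only.\<close>

lemma theta_plus_mean_pos: "0 < theta u q + gibbs_mean u q * q"
proof -
  have "gibbs u q e < 1" for e
    using gibbs_sum[of q] gibbs_pos[of q True] gibbs_pos[of q False] by (cases e) auto
  then have "0 < gibbs u q e * - log 2 (gibbs u q e)" for e
    using gibbs_pos[of q e] by (intro mult_pos_pos) auto
  then show ?thesis unfolding theta_plus_mean_eq_entropy by (intro add_pos_pos)
qed

lemma theta_has_derivative: "(theta u has_real_derivative - gibbs_mean u q) (at q)"
proof -
  have "((\<lambda>q. ln (u powr q + (1 - u) powr q) / ln 2) has_real_derivative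
      (u powr q * ln u + (1 - u) powr q * ln (1 - u)) / (u powr q + (1 - u) powr q) / ln 2) (at q)"
    using u partition_pos[of q] by (auto intro!: derivative_eq_intros)
  also have "(u powr q * ln u + (1 - u) powr q * ln (1 - u)) / (u powr q + (1 - u) powr q) / ln 2
      = - gibbs_mean u q"
    by (simp add: gibbs_mean_def gibbs_def coin_def log_def add_divide_distrib mult.commute)
  finally show ?thesis unfolding theta_def[abs_def] log_def .
qed

text \<open>Collects the dependence on q in a single power, from which monotonicity and solvability
  in q can be read off.\<close>

lemma gibbs_False_eq: "gibbs u q False = 1 / (1 + ((1 - u) / u) powr q)"
proof -
  have "u powr q > 0" using u by simp
  then show ?thesis
    using u partition_pos[of q] by (simp add: gibbs_def coin_def powr_divide field_simps)
qed

lemma gibbs_mean_eq: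
  "gibbs_mean u q = - log 2 (1 - u) + gibbs u q False * (log 2 (1 - u) - log 2 u)"
proof -
  have eq: "gibbs u q True = 1 - gibbs u q False" using gibbs_sum[of q] by simp
  show ?thesis unfolding gibbs_mean_def eq by (simp add: algebra_simps)
qed

text \<open>For u \<le> 1/2 growing q shifts weight away from the less likely symbol 0, whose
  information \<open>- log 2 u\<close> is the larger one.\<close>

lemma gibbs_mean_antimono:
  assumes "u \<le> 1/2" "q \<le> q'"
  shows "gibbs_mean u q' \<le> gibbs_mean u q"
proof -
  have "((1 - u) / u) powr q \<le> ((1 - u) / u) powr q'"
    using u assms by (intro powr_mono) auto
  then have "gibbs u q' False \<le> gibbs u q False"
    unfolding gibbs_False_eq using u by (intro divide_left_mono) (auto intro!: mult_pos_pos add_pos_nonneg)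
  moreover have "log 2 u \<le> log 2 (1 - u)" using u assms by simp
  ultimately show ?thesis unfolding gibbs_mean_eq by (intro add_left_mono mult_right_mono) auto
qed

text \<open>The mean is affine in the weight w of the symbol 0, which determines w in (0, 1). Then q
  solves R^q = 1/w - 1 with R = (1 - u)/u > 1.\<close>

lemma ex_gibbs_mean_eq:
  assumes "u < 1/2" "- log 2 (1 - u) < \<alpha>" "\<alpha> < - log 2 u"
  shows "\<exists>q. gibbs_mean u q = \<alpha>"
proof -
  define w where "w = (\<alpha> + log 2 (1 - u)) / (log 2 (1 - u) - log 2 u)"
  have d: "log 2 (1 - u) - log 2 u > 0" using u assms by simp
  have w: "0 < w" "w < 1" using assms d by (auto simp: w_def divide_simps)
  define R where "R = (1 - u) / u"
  have R: "R > 1" using u assms by (simp add: R_def)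
  define q where "q = log R (1 / w - 1)"
  have "1 / w - 1 > 0" using w by simp
  then have "R powr q = 1 / w - 1" using R by (simp add: q_def)
  then have "gibbs u q False = w" unfolding gibbs_False_eq R_def[symmetric] by simp
  then have "gibbs_mean u q = \<alpha>" unfolding gibbs_mean_eq using d by (simp add: w_def)
  then show ?thesis ..
qed

end

text \<open>For x \<le> 1/2 the x-derivative q (x^(q - 1) - (1 - x)^(q - 1)) of x^q + (1 - x)^q is
  nonnegative on 0 \<le> q \<le> 1 and nonpositive for other q.\<close>

lemma theta_compare:
  assumes u: "0 < u" "u \<le> v" "v \<le> 1/2"
  shows "q \<le> 0 \<or> 1 \<le> q \<Longrightarrow> theta v q \<le> theta u q"
    and "0 \<le> q \<Longrightarrow> q \<le> 1 \<Longrightarrow> theta u q \<le> theta v q"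
proof -
  define f where "f = (\<lambda>x::real. x powr q + (1 - x) powr q)"
  have f': "(f has_real_derivative q * (x powr (q - 1) - (1 - x) powr (q - 1))) (at x)"
    if "u \<le> x" "x \<le> v" for x
    unfolding f_def using that u by (auto intro!: derivative_eq_intros simp: algebra_simps)
  have log: "log 2 (f x) \<le> log 2 (f y)" if "f x \<le> f y" "x \<in> {u, v}" for x y
  proof -
    have "0 < f x" unfolding f_def using that(2) u by (intro add_pos_pos) auto
    then show ?thesis using that(1) by simp
  qed
  { assume q: "q \<le> 0 \<or> 1 \<le> q"
    have "f v \<le> f u"
    proof (rule DERIV_nonpos_imp_nonincreasing[OF u(2)])
      fix x assume x: "u \<le> x" "x \<le> v"
      have "q * (x powr (q - 1) - (1 - x) powr (q - 1)) \<le> 0"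
      proof (cases "q \<le> 0")
        case True
        then have "(1 - x) powr (q - 1) \<le> x powr (q - 1)" using x u by (intro powr_mono2') auto
        then show ?thesis using True by (simp add: mult_nonpos_nonneg)
      next
        case False
        then have "x powr (q - 1) \<le> (1 - x) powr (q - 1)" using x u q by (intro powr_mono2) auto
        then show ?thesis using False by (simp add: mult_nonneg_nonpos)
      qed
      then show "\<exists>y. DERIV f x :> y \<and> y \<le> 0" using f'[OF x] by blast
    qed
    then show "theta v q \<le> theta u q" using log[of v u] by (simp add: theta_def f_def)
  }
  { assume q: "0 \<le> q" "q \<le> 1"
    have "f u \<le> f v"
    proof (rule DERIV_nonneg_imp_nondecreasing[OF u(2)])
      fix x assume x: "u \<le> x" "x \<le> v"
      have "(1 - x) powr (q - 1) \<le> x powr (q - 1)" using x u q by (intro powr_mono2') auto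
      then have "0 \<le> q * (x powr (q - 1) - (1 - x) powr (q - 1))" using q by simp
      then show "\<exists>y. DERIV f x :> y \<and> 0 \<le> y" using f'[OF x] by blast
    qed
    then show "theta u q \<le> theta v q" using log[of u v] by (simp add: theta_def f_def)
  }
qed

section \<open>One-sided derivatives and infima\<close>

text \<open>Agreement is asked on a one-sided neighbourhood of length 1, which is the length of the
  interval [0, 1] where B follows one branch. It includes x, so the base values agree as
  well.\<close>

lemma left_deriv_eqI:
  assumes "(g has_real_derivative D) (at x)" "\<And>y. x - 1 < y \<Longrightarrow> y \<le> x \<Longrightarrow> f y = g y"
  shows "left_deriv f x = D"
  unfolding left_deriv_def
proof (rule tendsto_Lim)
  have "((\<lambda>y. (g y - g x) / (y - x)) \<longlongrightarrow> D) (at_left x)"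
    using has_field_derivative_at_within[OF assms(1), of "{..<x}"]
    by (simp add: has_field_derivative_iff)
  moreover have "\<forall>\<^sub>F y in at_left x. (g y - g x) / (y - x) = (f y - f x) / (y - x)"
    using eventually_at_left_real[of "x - 1" x] by (auto elim!: eventually_mono simp: assms(2))
  ultimately show "((\<lambda>y. (f y - f x) / (y - x)) \<longlongrightarrow> D) (at_left x)"
    by (rule Lim_transform_eventually)
qed simp

lemma right_deriv_eqI:
  assumes "(g has_real_derivative D) (at x)" "\<And>y. x \<le> y \<Longrightarrow> y < x + 1 \<Longrightarrow> f y = g y"
  shows "right_deriv f x = D"
  unfolding right_deriv_def
proof (rule tendsto_Lim)
  have "((\<lambda>y. (g y - g x) / (y - x)) \<longlongrightarrow> D) (at_right x)"
    using has_field_derivative_at_within[OF assms(1), of "{x<..}"]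
    by (simp add: has_field_derivative_iff)
  moreover have "\<forall>\<^sub>F y in at_right x. (g y - g x) / (y - x) = (f y - f x) / (y - x)"
    using eventually_at_right_real[of x "x + 1"] by (auto elim!: eventually_mono simp: assms(2))
  ultimately show "((\<lambda>y. (f y - f x) / (y - x)) \<longlongrightarrow> D) (at_right x)"
    by (rule Lim_transform_eventually)
qed simp

section \<open>Critical exponents and local dimensions\<close>

lemma Inf_ereal_image_le:
  assumes "\<And>t. a < t \<Longrightarrow> P t"
  shows "Inf (ereal ` {t. P t}) \<le> ereal a"
proof (rule ereal_le_epsilon2)
  fix e :: real assume "0 < e"
  then have "ereal (a + e) \<in> ereal ` {t. P t}" using assms by simp
  then show "Inf (ereal ` {t. P t}) \<le> ereal a + ereal e" by (simp add: Inf_lower)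
qed

lemma Inf_ereal_image_ge:
  assumes "\<And>t. t < a \<Longrightarrow> \<not> P t"
  shows "ereal a \<le> Inf (ereal ` {t. P t})"
  using assms by (intro Inf_greatest) (force simp: not_less[symmetric])

text \<open>The argument common to both dimensions: \<open>D\<close> stands for vanishing of the
  s-dimensional measure of the level set, \<open>Z\<close> for vanishing of the multifractal
  measure. \<open>Z q t\<close> forces \<open>D s\<close> for s > t + \<alpha> q; since
  \<open>D\<close> fails below h, this bounds the infimum from below for all q at once, and
  \<open>q0\<close> attains it.\<close>

lemma critical_exponent_eq_INF:
  assumes "0 < h"
    and ge: "\<And>s. s < h \<Longrightarrow> \<not> D s"
    and le: "\<And>q t s. Z q t \<Longrightarrow> 0 < s \<Longrightarrow> t + \<alpha> * q < s \<Longrightarrow> D s"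
    and ex: "a + \<alpha> * q0 \<le> h" "\<And>t. a < t \<Longrightarrow> Z q0 t"
  shows "Inf (ereal ` {s. 0 \<le> s \<and> D s}) = (INF q. Inf (ereal ` {t. Z q t}) + ereal (\<alpha> * q))"
proof -
  have D: "D s" if "h < s" for s
  proof (rule le)
    have "a < s - \<alpha> * q0" using ex(1) that by simp
    \<comment> \<open>The midpoint of the interval from a to s - \<alpha> q0.\<close>
    then show "Z q0 ((a + (s - \<alpha> * q0)) / 2)" by (intro ex(2)) simp
    show "0 < s" using \<open>0 < h\<close> that by simp
    show "(a + (s - \<alpha> * q0)) / 2 + \<alpha> * q0 < s" using \<open>a < s - \<alpha> * q0\<close> by (simp add: field_simps)
  qed
  have "Inf (ereal ` {s. 0 \<le> s \<and> D s}) = ereal h"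
    using D ge \<open>0 < h\<close> by (intro antisym Inf_ereal_image_le Inf_ereal_image_ge) auto
  moreover have "(INF q. Inf (ereal ` {t. Z q t}) + ereal (\<alpha> * q)) = ereal h"
  proof (rule antisym)
    have "(INF q. Inf (ereal ` {t. Z q t}) + ereal (\<alpha> * q)) \<le> Inf (ereal ` {t. Z q0 t}) + ereal (\<alpha> * q0)"
      by (rule INF_lower) simp
    also have "\<dots> \<le> ereal a + ereal (\<alpha> * q0)"
      using ex(2) by (intro add_right_mono Inf_ereal_image_le)
    also have "\<dots> \<le> ereal h" using ex(1) by simp
    finally show "(INF q. Inf (ereal ` {t. Z q t}) + ereal (\<alpha> * q)) \<le> ereal h" .
    show "ereal h \<le> (INF q. Inf (ereal ` {t. Z q t}) + ereal (\<alpha> * q))"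
    proof (rule INF_greatest)
      fix q
      have "\<not> Z q t" if "t < h - \<alpha> * q" for t
      proof
        assume "Z q t"
        \<comment> \<open>The exponent s found here must be positive to use \<open>le\<close>, which
          is where h > 0 enters.\<close>
        have "max 0 (t + \<alpha> * q) < h" using that \<open>0 < h\<close> by simp
        then obtain s where "max 0 (t + \<alpha> * q) < s" "s < h" using dense by blast
        then show False using le[OF \<open>Z q t\<close>, of s] ge[of s] by auto
      qed
      then have "ereal (h - \<alpha> * q) \<le> Inf (ereal ` {t. Z q t})" by (rule Inf_ereal_image_ge)
      then have "ereal (h - \<alpha> * q) + ereal (\<alpha> * q) \<le> Inf (ereal ` {t. Z q t}) + ereal (\<alpha> * q)"
        by (rule add_right_mono)
      then show "ereal h \<le> Inf (ereal ` {t. Z q t}) + ereal (\<alpha> * q)" by simp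
    qed
  qed
  ultimately show ?thesis by simp
qed

text \<open>For 2^-n < r \<le> 2^(1 - n) the ball is the cylinder of order n and - log2 r lies
  between n - 1 and n. The quotient is thus squeezed between a(n)/n and a(n)/(n - 1), which have the
  same limit.\<close>

lemma level_setI:
  fixes \<mu> :: "cantor measure"
  assumes pos: "\<And>n. 0 < measure \<mu> (cylinder (coord x) n)" and le1: "\<And>n. measure \<mu> (cylinder (coord x) n) \<le> 1"
    and lim: "(\<lambda>n. - log 2 (measure \<mu> (cylinder (coord x) n)) / real n) \<longlonglongrightarrow> \<alpha>"
  shows "x \<in> level_set \<mu> \<alpha>"
proof -
  define a where "a = (\<lambda>n. - log 2 (measure \<mu> (cylinder (coord x) n)))"
  have a0: "0 \<le> a n" for n using pos[of n] le1[of n] by (simp add: a_def)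
  have lim': "(\<lambda>n. a n / real n) \<longlonglongrightarrow> \<alpha>" using lim by (simp add: a_def)
  have "(\<lambda>n. real n / (real n - 1)) \<longlonglongrightarrow> 1" by real_asymp
  then have "(\<lambda>n. a n / real n * (real n / (real n - 1))) \<longlonglongrightarrow> \<alpha>"
    using tendsto_mult[OF lim'] by fastforce
  then have lim'': "(\<lambda>n. a n / (real n - 1)) \<longlonglongrightarrow> \<alpha>"
  proof (rule Lim_transform_eventually)
    show "\<forall>\<^sub>F n in sequentially. a n / real n * (real n / (real n - 1)) = a n / (real n - 1)"
      using eventually_gt_at_top[of 0] by eventually_elim simp
  qed
  have "((\<lambda>r. ln (measure \<mu> (ball x r)) / ln r) \<longlongrightarrow> \<alpha>) (at_right 0)"
  proof (rule tendstoI)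
    fix e :: real assume "0 < e"
    have "\<forall>\<^sub>F n in sequentially. \<alpha> - e < a n / real n \<and> a n / (real n - 1) < \<alpha> + e \<and> n \<ge> 2"
      using order_tendstoD(1)[OF lim', of "\<alpha> - e"] order_tendstoD(2)[OF lim'', of "\<alpha> + e"]
        eventually_ge_at_top[of "2::nat"] \<open>0 < e\<close> by (auto intro!: eventually_conj)
    then obtain M where M: "\<And>n. n \<ge> M \<Longrightarrow> \<alpha> - e < a n / real n \<and> a n / (real n - 1) < \<alpha> + e \<and> n \<ge> 2"
      by (auto simp: eventually_sequentially)
    have "dist (ln (measure \<mu> (ball x r)) / ln r) \<alpha> < e" if r: "0 < r" "r < (1/2) ^ M" for r
    proof -
      have "(1/2::real) ^ M \<le> 1" by (rule power_le_one) auto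
      then have "r \<le> 1" using r by linarith
      then obtain n where n: "(1/2) ^ n < r" "r \<le> 2 * (1/2) ^ n"
        using dyadic_bracket r(1) by blast
      have "(1/2::real) ^ n < (1/2) ^ M" using n r by linarith
      then have "M < n" by (subst (asm) power_strict_decreasing_iff) auto
      note Mn = M[OF less_imp_le[OF this]]
      have half: "log 2 ((1/2) ^ n) = - real n" by (simp add: log_nat_power log_divide)
      have "- real n < log 2 r" using n(1) r(1) unfolding half[symmetric] by simp
      moreover have "log 2 r \<le> log 2 (2 * (1/2) ^ n)" using n(2) r(1) by simp
      then have "log 2 r \<le> 1 - real n" using half by (simp add: log_mult)
      ultimately have L: "real n - 1 \<le> - log 2 r" "- log 2 r < real n" by auto
      have "ln (measure \<mu> (ball x r)) / ln r = a n / (- log 2 r)"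
        unfolding ball_cantor_eq_cylinder[OF n] a_def by (simp add: log_def)
      moreover have "a n / real n \<le> a n / (- log 2 r)"
        using L Mn a0[of n] by (intro divide_left_mono mult_pos_pos) auto
      moreover have "a n / (- log 2 r) \<le> a n / (real n - 1)"
        using L Mn a0[of n] by (intro divide_left_mono mult_pos_pos) auto
      ultimately show ?thesis using Mn unfolding dist_real_def abs_less_iff by linarith
    qed
    then show "\<forall>\<^sub>F r in at_right 0. dist (ln (measure \<mu> (ball x r)) / ln r) \<alpha> < e"
      unfolding eventually_at_right_field by (intro exI[of _ "(1/2) ^ M"]) auto
  qed
  then show ?thesis by (simp add: level_set_def)
qed

section \<open>The alternating measure\<close>

locale alternating_coins =
  fixes p pt :: real
    and t :: "nat \<Rightarrow> nat"
    and \<omega> :: "nat \<Rightarrow> bool \<Rightarrow> real"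
    and \<mu> :: "cantor measure"
  assumes p: "0 < p" "p < pt" "pt \<le> 1/2"
    and t: "t 0 = 1" "strict_mono t"
    and t_lim: "(\<lambda>n. real (t n) / real (t (Suc n))) \<longlonglongrightarrow> 0"
    and \<omega>_odd: "\<And>j k e. k \<ge> 1 \<Longrightarrow> t (2 * k - 1) \<le> j \<Longrightarrow> j < t (2 * k) \<Longrightarrow>
                   \<omega> j e = (if e then 1 - p else p)"
    and \<omega>_even: "\<And>j k e. t (2 * k) \<le> j \<Longrightarrow> j < t (2 * k + 1) \<Longrightarrow>
                   \<omega> j e = (if e then 1 - pt else pt)"
    and \<mu>: "prob_space \<mu>"
    and \<mu>_cyl: "\<And>\<epsilon> n. measure \<mu> (cylinder \<epsilon> n) = (\<Prod>j=1..n. \<omega> j (\<epsilon> j))"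
begin

text \<open>Coordinates start at \<open>1\<close>; the value at \<open>0\<close> only ensures \<open>bias j \<in> {p, pt}\<close> throughout.\<close>

definition bias :: "nat \<Rightarrow> real" where
  "bias j = (if j = 0 then p else \<omega> j False)"

lemma t_ge: "n < t n"
proof (induction n)
  case (Suc n)
  have "t n < t (Suc n)" using t(2) by (rule strict_monoD) simp
  then show ?case using Suc by simp
qed (simp add: t)

text \<open>Blocks are written as \<open>2 * k + d\<close>, with d = 1 for \<open>p\<close> and d =
  0 for \<open>pt\<close>, to match the pattern in \<open>infinite_block_sums\<close>.\<close>

lemma omega_odd_block: "t (2 * k + 1) \<le> j \<Longrightarrow> j < t (2 * k + 1 + 1) \<Longrightarrow> \<omega> j e = coin p e"
  using \<omega>_odd[of "k + 1" j e] by (simp add: coin_def)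

lemma omega_even_block: "t (2 * k + 0) \<le> j \<Longrightarrow> j < t (2 * k + 0 + 1) \<Longrightarrow> \<omega> j e = coin pt e"
  using \<omega>_even[of k j e] by (simp add: coin_def)

lemma bias_odd: "t (2 * k + 1) \<le> j \<Longrightarrow> j < t (2 * k + 1 + 1) \<Longrightarrow> bias j = p"
  using omega_odd_block[of k j False] t_ge[of "2 * k + 1"] by (auto simp: bias_def coin_def)

lemma bias_even: "t (2 * k + 0) \<le> j \<Longrightarrow> j < t (2 * k + 0 + 1) \<Longrightarrow> bias j = pt"
  using omega_even_block[of k j False] t_ge[of "2 * k"] by (auto simp: bias_def coin_def)

lemma ex_block: "1 \<le> j \<Longrightarrow> \<exists>n. t n \<le> j \<and> j < t (Suc n)"
proof -
  assume "1 \<le> j"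
  define n where "n = (LEAST n. j < t n)"
  have n: "j < t n" unfolding n_def by (rule LeastI[of _ j]) (rule t_ge)
  then obtain m where m: "n = Suc m" using t(1) \<open>1 \<le> j\<close> by (cases n) auto
  have "\<not> j < t m" using not_less_Least[of m "\<lambda>n. j < t n"] m unfolding n_def by auto
  then show ?thesis using n m by (auto simp: not_less)
qed

lemma omega_cases: "1 \<le> j \<Longrightarrow> \<omega> j = coin p \<or> \<omega> j = coin pt"
proof -
  assume "1 \<le> j"
  then obtain n where n: "t n \<le> j" "j < t (Suc n)" using ex_block by blast
  show ?thesis
  proof (cases "even n")
    case True
    then obtain k where "n = 2 * k" by blast
    then show ?thesis using n omega_even_block[of k j] by auto
  next
    case False
    then obtain k where "n = 2 * k + 1" by (elim oddE)
    then show ?thesis using n omega_odd_block[of k j] by auto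
  qed
qed

lemma bias_cases: "bias j = p \<or> bias j = pt"
  using omega_cases[of j] by (cases "j = 0") (auto simp: bias_def coin_def)

lemma omega_eq: "1 \<le> j \<Longrightarrow> \<omega> j e = coin (bias j) e"
  using omega_cases[of j] by (auto simp: bias_def coin_def)

lemma bias_bounds: "0 < bias j" "bias j < 1"
  using bias_cases[of j] p by auto

lemma measure_cylinder: "measure \<mu> (cylinder \<epsilon> n) = (\<Prod>j=1..n. coin (bias j) (\<epsilon> j))"
  unfolding \<mu>_cyl by (intro prod.cong) (auto simp: omega_eq)

lemma measure_cylinder_pos: "0 < measure \<mu> (cylinder \<epsilon> n)"
  unfolding measure_cylinder by (intro prod_pos) (auto intro: coin_pos bias_bounds)

lemma measure_ball_pos: "0 < r \<Longrightarrow> 0 < measure \<mu> (ball x r)"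
proof -
  assume "0 < r"
  interpret prob_space \<mu> by (rule \<mu>)
  show ?thesis
  proof (cases "r \<le> 1")
    case True
    then obtain n where "(1/2) ^ n < r" "r \<le> 2 * (1/2) ^ n" using dyadic_bracket \<open>0 < r\<close> by blast
    then show ?thesis using measure_cylinder_pos ball_cantor_eq_cylinder by metis
  next
    case False
    have "ball x r = cylinder (coord x) 0"
    proof -
      have "dist x y < r" for y using dist_cantor_le_iff[of x y 0] False by simp
      then show ?thesis by (auto simp: cylinder_def)
    qed
    then show ?thesis using measure_cylinder_pos by simp
  qed
qed

lemma msupport_eq_UNIV: "msupport \<mu> = UNIV"
proof -
  interpret prob_space \<mu> by (rule \<mu>)
  have "emeasure \<mu> (ball x r) \<noteq> 0" if "0 < r" for x r
    using measure_ball_pos[OF that, of x] by (auto simp: emeasure_eq_measure)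
  then show ?thesis unfolding msupport_def by auto
qed

text \<open>At the last index of a late block of the given parity, all earlier blocks together are a
  negligible fraction by \<open>t_lim\<close>, so the running average is close to the value
  \<open>a\<close> of that block.\<close>

lemma infinite_block_sums:
  fixes v :: "nat \<Rightarrow> real"
  assumes v: "\<And>k j. t (2 * k + d) \<le> j \<Longrightarrow> j < t (2 * k + d + 1) \<Longrightarrow> v j = a"
    and C: "\<And>j. \<bar>v j - a\<bar> \<le> C" and b: "b < a"
  shows "infinite {n. b * real n + c \<le> (\<Sum>j=1..n. v j)}"
  unfolding infinite_nat_iff_unbounded_le
proof
  fix N :: nat
  have "C \<ge> 0" using C[of 0] by linarith
  obtain D where D: "0 < D" "C \<le> D" using \<open>C \<ge> 0\<close> by (intro that[of "C + 1"]) auto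
  \<comment> \<open>Chosen so that the earlier blocks cost at most (a - b)/4 times t(m + 1). The
    constant c gets the same allowance, and the sum of both is at most (a - b) n since t(m + 1)
    \<le> 2 n.\<close>
  define e where "e = (a - b) / (4 * D)"
  have "e > 0" using b D by (simp add: e_def)
  have "\<forall>\<^sub>F m in sequentially. real (t m) / real (t (Suc m)) < e"
    using t_lim \<open>e > 0\<close> by (rule order_tendstoD)
  then obtain M where M: "\<And>m. m \<ge> M \<Longrightarrow> real (t m) / real (t (Suc m)) < e"
    by (auto simp: eventually_sequentially)
  obtain M' where M': "4 * c / (a - b) \<le> real M'" using real_arch_simple by blast
  define k where "k = max M (max M' (max N 1))"
  define m where "m = 2 * k + d"
  have m: "m \<ge> M" "m \<ge> M'" "m \<ge> N" "m \<ge> 1" by (auto simp: m_def k_def)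
  \<comment> \<open>The last index of block m, as blocks are half-open.\<close>
  define n where "n = t (Suc m) - 1"
  have tm: "t m < t (Suc m)" using t(2) by (rule strict_monoD) simp
  have t1: "t m \<ge> 1" "t (Suc m) \<ge> 2" "t (Suc m) > m" using t_ge[of m] t_ge[of "Suc m"] m by auto
  have rn: "real n = real (t (Suc m)) - 1" using t1 by (simp add: n_def of_nat_diff)
  have n: "n \<ge> N" "t m \<le> n" using t1 tm m by (auto simp: n_def)
  have "(\<Sum>j=1..n. v j - a) = (\<Sum>j\<in>{1..<t m}. v j - a) + (\<Sum>j\<in>{t m..n}. v j - a)"
    using n t1 by (subst sum.union_disjoint[symmetric]) (auto intro!: sum.cong)
  also have "(\<Sum>j\<in>{t m..n}. v j - a) = 0"
    using v[of k] t1 by (intro sum.neutral) (auto simp: m_def n_def)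
  finally have "\<bar>\<Sum>j=1..n. v j - a\<bar> \<le> (\<Sum>j\<in>{1..<t m}. \<bar>v j - a\<bar>)" by simp
  also have "\<dots> \<le> (\<Sum>j\<in>{1..<t m}. C)" by (intro sum_mono C)
  also have "\<dots> \<le> C * real (t m)" using \<open>C \<ge> 0\<close> t1 by (simp add: of_nat_diff algebra_simps)
  finally have 1: "a * real n - C * real (t m) \<le> (\<Sum>j=1..n. v j)"
    by (simp add: sum_subtractf abs_le_iff algebra_simps)
  have "real (t m) \<le> e * real (t (Suc m))" using M[OF m(1)] t1 by (simp add: field_simps)
  then have "D * real (t m) \<le> D * (e * real (t (Suc m)))"
    using D by (intro mult_left_mono) auto
  also have "\<dots> = (a - b) / 4 * real (t (Suc m))" using D by (simp add: e_def)
  finally have 2: "C * real (t m) \<le> (a - b) / 4 * real (t (Suc m))"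
    using D by (meson mult_right_mono of_nat_0_le_iff order.trans)
  have "4 * c / (a - b) \<le> real (t (Suc m))" using M' m(2) t1(3) by linarith
  then have 3: "c \<le> (a - b) / 4 * real (t (Suc m))" using b by (simp add: field_simps)
  have 4: "2 * ((a - b) / 4 * real (t (Suc m))) \<le> a * real n - b * real n"
  proof -
    have "real (t (Suc m)) \<le> 2 * real n" unfolding rn using t1 by simp
    then have "(a - b) / 2 * real (t (Suc m)) \<le> (a - b) / 2 * (2 * real n)"
      using b by (intro mult_left_mono) auto
    then show ?thesis by (simp add: algebra_simps)
  qed
  have "b * real n + c \<le> (\<Sum>j=1..n. v j)" using 1 2 3 4 by linarith
  then show "\<exists>n\<ge>N. n \<in> {n. b * real n + c \<le> (\<Sum>j=1..n. v j)}" using n by blast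
qed

lemma infinite_bias_sums:
  assumes "u = p \<or> u = pt" "b < g u"
  shows "infinite {n. b * real n + c \<le> (\<Sum>j=1..n. g (bias j))}"
proof -
  define C where "C = \<bar>g p - g u\<bar> + \<bar>g pt - g u\<bar>"
  have C: "\<bar>g (bias j) - g u\<bar> \<le> C" for j
    using bias_cases[of j] by (auto simp: C_def)
  show ?thesis using assms(1)
  proof
    assume "u = p"
    then show ?thesis
      using C assms(2) bias_odd by (intro infinite_block_sums[where d = 1 and C = C and a = "g u"]) auto
  next
    assume "u = pt"
    then show ?thesis
      using C assms(2) bias_even by (intro infinite_block_sums[where d = 0 and C = C and a = "g u"]) auto
  qed
qed

section \<open>Partition sums and the functions b and B\<close>

lemma measure_cylinder_powr:
  "measure \<mu> (cylinder \<epsilon> n) powr q = (\<Prod>j=1..n. coin (bias j) (\<epsilon> j) powr q)"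
  unfolding measure_cylinder
  by (rule prod_powr_distrib)

lemma sum_cylinder_powr:
  "(\<Sum>\<epsilon>\<in>words n. measure \<mu> (cylinder \<epsilon> n) powr q) = 2 powr (\<Sum>j=1..n. theta (bias j) q)"
proof -
  have "(\<Sum>\<epsilon>\<in>words n. measure \<mu> (cylinder \<epsilon> n) powr q)
      = (\<Prod>j=1..n. coin (bias j) True powr q + coin (bias j) False powr q)"
    unfolding measure_cylinder_powr by (rule sum_words)
  also have "\<dots> = (\<Prod>j=1..n. 2 powr theta (bias j) q)"
    by (intro prod.cong) (auto simp: powr_theta[OF bias_bounds] coin_def)
  finally show ?thesis by (simp add: powr_sum)
qed

text \<open>Hence b(q) is at most theta of either bias: at the ends of long blocks ruled by u, the
  partition sum is at most 2^(a n). Both signs are flipped since \<open>infinite_bias_sums\<close>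
  bounds sums from below.\<close>

lemma mf_hausdorff_eq_0:
  assumes "u = p \<or> u = pt" "theta u q < s"
  shows "mf_hausdorff \<mu> q s UNIV = 0"
proof -
  obtain a where a: "theta u q < a" "a < s" using assms dense by blast
  have "infinite {n. - a * real n + 0 \<le> (\<Sum>j=1..n. - theta (bias j) q)}"
    using assms(1) a by (intro infinite_bias_sums[where g = "\<lambda>u. - theta u q"]) auto
  then show ?thesis
  proof (rule mf_hausdorff_zero[OF _ a(2)])
    fix n assume "n \<in> {n. - a * real n + 0 \<le> (\<Sum>j=1..n. - theta (bias j) q)}"
    then show "(\<Sum>\<epsilon>\<in>words n. measure \<mu> (cylinder \<epsilon> n) powr q) \<le> 2 powr (a * real n)"
      unfolding sum_cylinder_powr by (intro powr_mono) (auto simp: sum_negf)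
  qed
qed

lemma mf_packing_eq_0:
  assumes "max (theta p q) (theta pt q) < s"
  shows "mf_packing \<mu> q s UNIV = 0"
proof (rule mf_packing_zero[OF assms])
  fix n
  have "(\<Sum>j=1..n. theta (bias j) q) \<le> (\<Sum>j=1..n. max (theta p q) (theta pt q))"
    by (intro sum_mono) (use bias_cases in \<open>metis max.cobounded1 max.cobounded2\<close>)
  then show "(\<Sum>\<epsilon>\<in>words n. measure \<mu> (cylinder \<epsilon> n) powr q)
      \<le> 2 powr (max (theta p q) (theta pt q) * real n)"
    unfolding sum_cylinder_powr by (intro powr_mono) (auto simp: mult.commute)
qed

text \<open>The Gibbs measure with the same q on all blocks has mass \<mu>^q 2^(- S) on cylinders,
  where S is the running sum of theta. At the ends of blocks ruled by u, S is large enough for the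
  mass distribution lemma.\<close>

lemma mf_packing_neq_0:
  assumes u: "u = p \<or> u = pt" "s < theta u q"
  shows "mf_packing \<mu> q s UNIV \<noteq> 0"
proof -
  have nn: "0 \<le> gibbs (bias j) q e" for j e
    by (rule less_imp_le) (rule gibbs_pos[OF bias_bounds])
  have one: "gibbs (bias j) q True + gibbs (bias j) q False = 1" for j
    by (rule gibbs_sum[OF bias_bounds])
  obtain N where N: "prob_space N" "sets N = sets borel"
    "\<And>\<epsilon> n. measure N (cylinder \<epsilon> n) = (\<Prod>j=1..n. gibbs (bias j) q (\<epsilon> j))"
    by (rule ex_product_measure[OF nn one]) (rule that)
  interpret prob_space N by (rule N)
  \<comment> \<open>The offset - s accounts for the factor 2 in the radius: (2 * 2^-n)^s = 2^(s - s
    n).\<close>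
  define K where "K = {n. s * real n + (- s) \<le> (\<Sum>j=1..n. theta (bias j) q)}"
  show ?thesis
  proof (rule mf_packing_nonzero[OF N(1,2), where A = UNIV and K = K])
    have "space N = UNIV" using sets_eq_imp_space_eq[OF N(2)] by simp
    then show "UNIV \<in> sets N" "0 < measure N UNIV"
      using sets.top[of N] prob_space by auto
    show "infinite K" unfolding K_def by (rule infinite_bias_sums[OF u(1), where g = "\<lambda>u. theta u q"]) (rule u)
    show "0 < measure \<mu> (cylinder \<epsilon> n)" for \<epsilon> n by (rule measure_cylinder_pos)
    show "measure N (cylinder (coord x) n)
        \<le> (2 * (1/2) ^ n) powr s * measure \<mu> (cylinder (coord x) n) powr q" if "n \<in> K" for x n
    proof -
      have "measure N (cylinder (coord x) n)
          = (\<Prod>j=1..n. coin (bias j) (coord x j) powr q * 2 powr (- theta (bias j) q))"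
        unfolding N(3) by (intro prod.cong refl gibbs_eq bias_bounds)
      also have "\<dots> = measure \<mu> (cylinder (coord x) n) powr q * 2 powr (\<Sum>j=1..n. - theta (bias j) q)"
        unfolding measure_cylinder_powr by (simp add: prod.distrib powr_sum)
      also have "\<dots> \<le> measure \<mu> (cylinder (coord x) n) powr q * 2 powr (s - s * real n)"
        using that by (intro mult_left_mono powr_mono) (auto simp: K_def sum_negf)
      also have "2 powr (s - s * real n) = (2 * (1/2) ^ n) powr s"
        unfolding powr_mult half_power_powr by (simp flip: powr_add)
      finally show ?thesis by (simp only: mult.commute)
    qed
  qed auto
qed

text \<open>Here q depends on the bias, but the mean information under the tilted weights is
  \<alpha> on every block, so almost every point is in the level set. The strong law applied to
  \<open>f2\<close> makes the mass of cylinders decay with the running sum of entropies.\<close>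

lemma ex_level_measure:
  assumes mean: "gibbs_mean p (Q p) = \<alpha>" "gibbs_mean pt (Q pt) = \<alpha>" and e: "0 < e"
  defines "H \<equiv> \<lambda>u. theta u (Q u) + gibbs_mean u (Q u) * Q u"
  obtains N A m where "prob_space N" "sets N = sets borel" "A \<in> sets N" "measure N A > 0"
    "AE x in N. x \<in> A \<longrightarrow> x \<in> level_set \<mu> \<alpha>"
    "\<And>x n. x \<in> A \<Longrightarrow> m \<le> n \<Longrightarrow>
       measure N (cylinder (coord x) n) \<le> 2 powr (e * real n - (\<Sum>j=1..n. H (bias j)))"
proof -
  define w where "w = (\<lambda>j. gibbs (bias j) (Q (bias j)))"
  have w: "0 < w j e" "w j True + w j False = 1" for j e
    unfolding w_def using gibbs_pos gibbs_sum bias_bounds by auto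
  obtain N where N: "prob_space N" "sets N = sets borel"
    "\<And>\<epsilon> n. measure N (cylinder \<epsilon> n) = (\<Prod>j=1..n. w j (\<epsilon> j))"
    and slln: "\<And>f C. (\<And>j e. \<bar>f j e\<bar> \<le> C) \<Longrightarrow>
       AE x in N. (\<lambda>n. (\<Sum>j=1..n. f j (coord x j) - (w j True * f j True + w j False * f j False)) / real n)
         \<longlonglongrightarrow> (0::real)"
    by (rule ex_product_measure[of w]) (use w in \<open>auto intro: less_imp_le\<close>)
  interpret prob_space N by (rule N)
  have bounded: "\<exists>C. \<forall>j c. \<bar>F (bias j) c\<bar> \<le> C" for F :: "real \<Rightarrow> bool \<Rightarrow> real"
  proof (intro exI allI)
    fix j c
    show "\<bar>F (bias j) c\<bar> \<le> \<bar>F p True\<bar> + \<bar>F p False\<bar> + \<bar>F pt True\<bar> + \<bar>F pt False\<bar>"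
      using bias_cases[of j] by (cases c) auto
  qed
  define f1 where "f1 = (\<lambda>j c. - log 2 (coin (bias j) c))"
  define f2 where "f2 = (\<lambda>j c. - log 2 (w j c))"
  have E1: "w j True * f1 j True + w j False * f1 j False = \<alpha>" for j
    using bias_cases[of j] mean by (auto simp: w_def f1_def gibbs_mean_def coin_def)
  have E2: "w j True * f2 j True + w j False * f2 j False = H (bias j)" for j
    unfolding H_def theta_plus_mean_eq_entropy[OF bias_bounds] w_def f2_def ..
  obtain C1 where "\<forall>j c. \<bar>f1 j c\<bar> \<le> C1"
    using bounded[of "\<lambda>u c. - log 2 (coin u c)"] unfolding f1_def by (rule exE)
  then have C1: "\<And>j c. \<bar>f1 j c\<bar> \<le> C1" by simp
  have "AE x in N. (\<lambda>n. (\<Sum>j=1..n. f1 j (coord x j) - \<alpha>) / real n) \<longlonglongrightarrow> 0"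
    using slln[of f1, OF C1] unfolding E1 .
  then have level: "AE x in N. x \<in> level_set \<mu> \<alpha>"
  proof eventually_elim
    case (elim x)
    have logm: "- log 2 (measure \<mu> (cylinder (coord x) n)) = (\<Sum>j=1..n. f1 j (coord x j))" for n
    proof -
      have "measure \<mu> (cylinder (coord x) n) = 2 powr - (\<Sum>j=1..n. f1 j (coord x j))"
        unfolding measure_cylinder sum_negf[symmetric] powr_sum[OF zero_neq_numeral[symmetric]]
        by (intro prod.cong) (auto simp: f1_def coin_pos bias_bounds)
      then show ?thesis by simp
    qed
    have "(\<lambda>n. (\<Sum>j=1..n. f1 j (coord x j) - \<alpha>) / real n + \<alpha>) \<longlonglongrightarrow> 0 + \<alpha>"
      by (intro tendsto_intros elim)
    then have "(\<lambda>n. (\<Sum>j=1..n. f1 j (coord x j) - \<alpha>) / real n + \<alpha>) \<longlonglongrightarrow> \<alpha>" by simp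
    then have "(\<lambda>n. (\<Sum>j=1..n. f1 j (coord x j)) / real n) \<longlonglongrightarrow> \<alpha>"
    proof (rule Lim_transform_eventually)
      show "\<forall>\<^sub>F n in sequentially. (\<Sum>j=1..n. f1 j (coord x j) - \<alpha>) / real n + \<alpha>
          = (\<Sum>j=1..n. f1 j (coord x j)) / real n"
        using eventually_gt_at_top[of 0] by eventually_elim (simp add: sum_subtractf field_simps)
    qed
    then show ?case
      unfolding logm[symmetric]
      by (intro level_setI measure_cylinder_pos prob_space.prob_le_1[OF \<mu>])
  qed
  \<comment> \<open>An Egorov-type exhaustion: on \<open>A m\<close> the entropy estimate holds from
    m on. The union over m has full measure, so some \<open>A m\<close> has positive
    measure.\<close>
  define A where "A = (\<lambda>m. {x. \<forall>n\<ge>m. (\<Sum>j=1..n. H (bias j)) - e * real n \<le> (\<Sum>j=1..n. f2 j (coord x j))})"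
  have A_sets: "A m \<in> sets N" for m
  proof -
    have [measurable]: "(\<lambda>x. \<Sum>j=1..n. f2 j (coord x j)) \<in> borel_measurable borel" for n
      by (rule borel_measurable_coord_sum)
    have "{x \<in> space borel. \<forall>n\<ge>m. (\<Sum>j=1..n. H (bias j)) - e * real n \<le> (\<Sum>j=1..n. f2 j (coord x j))}
        \<in> sets borel" by measurable
    then show ?thesis unfolding A_def N(2) by (simp only: space_borel UNIV_I simp_thms)
  qed
  obtain C2 where "\<forall>j c. \<bar>f2 j c\<bar> \<le> C2"
    using bounded[of "\<lambda>u c. - log 2 (gibbs u (Q u) c)"] unfolding f2_def w_def by (rule exE)
  then have C2: "\<And>j c. \<bar>f2 j c\<bar> \<le> C2" by simp
  have "AE x in N. (\<lambda>n. (\<Sum>j=1..n. f2 j (coord x j) - H (bias j)) / real n) \<longlonglongrightarrow> 0"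
    using slln[of f2, OF C2] unfolding E2 .
  then have "AE x in N. x \<in> (\<Union>m. A m)"
  proof eventually_elim
    case (elim x)
    then have "\<forall>\<^sub>F n in sequentially. - e < (\<Sum>j=1..n. f2 j (coord x j) - H (bias j)) / real n"
      by (rule order_tendstoD) (use e in simp)
    then have "\<forall>\<^sub>F n in sequentially.
        (\<Sum>j=1..n. H (bias j)) - e * real n \<le> (\<Sum>j=1..n. f2 j (coord x j))"
      using eventually_gt_at_top[of 0] by eventually_elim (simp add: sum_subtractf field_simps)
    then show ?case by (auto simp: A_def eventually_sequentially)
  qed
  then have "prob (\<Union>m. A m) = 1" using A_sets by (intro prob_eq_1[THEN iffD2]) auto
  have "\<exists>m. measure N (A m) > 0"
  proof (rule ccontr)
    assume "\<not> ?thesis"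
    then have "A m \<in> null_sets N" for m
      using A_sets[of m] by (auto simp: null_sets_def emeasure_eq_measure not_less measure_le_0_iff)
    then have "(\<Union>m. A m) \<in> null_sets N" by (rule null_sets_UN)
    then show False using \<open>prob (\<Union>m. A m) = 1\<close> by (simp add: null_sets_def emeasure_eq_measure)
  qed
  then obtain m where m: "measure N (A m) > 0" by blast
  show thesis
  proof (rule that[OF N(1,2) A_sets m])
    show "AE x in N. x \<in> A m \<longrightarrow> x \<in> level_set \<mu> \<alpha>" using level by eventually_elim simp
    show "measure N (cylinder (coord x) n) \<le> 2 powr (e * real n - (\<Sum>j=1..n. H (bias j)))"
      if "x \<in> A m" "m \<le> n" for x n
    proof -
      have "measure N (cylinder (coord x) n) = 2 powr - (\<Sum>j=1..n. f2 j (coord x j))"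
        unfolding N(3) sum_negf[symmetric] powr_sum[OF zero_neq_numeral[symmetric]]
        by (intro prod.cong) (auto simp: f2_def w)
      also have "\<dots> \<le> 2 powr (e * real n - (\<Sum>j=1..n. H (bias j)))"
        using that by (intro powr_mono) (auto simp: A_def)
      finally show ?thesis .
    qed
  qed
qed

text \<open>Every running average of the entropies is at least the minimum, which serves the
  Hausdorff measure. Infinitely many come close to the maximum, which suffices for the packing
  measure.\<close>

lemma level_set_lower_bounds:
  assumes mean: "gibbs_mean p (Q p) = \<alpha>" "gibbs_mean pt (Q pt) = \<alpha>"
  defines "H \<equiv> \<lambda>u. theta u (Q u) + \<alpha> * Q u"
  shows "s < min (H p) (H pt) \<Longrightarrow> hausdorff_measure s (level_set \<mu> \<alpha>) \<noteq> 0"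
    and "s < max (H p) (H pt) \<Longrightarrow> packing_measure s (level_set \<mu> \<alpha>) \<noteq> 0"
proof -
  have H: "theta (bias j) (Q (bias j)) + gibbs_mean (bias j) (Q (bias j)) * Q (bias j) = H (bias j)" for j
    using bias_cases[of j] mean by (auto simp: H_def)
  { assume s: "s < min (H p) (H pt)"
    have pos: "0 < min (H p) (H pt)"
      using theta_plus_mean_pos[of p "Q p"] theta_plus_mean_pos[of pt "Q pt"] p mean by (simp add: H_def)
    obtain s' where s': "max 0 s < s'" "s' < min (H p) (H pt)"
      using dense[of "max 0 s" "min (H p) (H pt)"] s pos by auto
    define e where "e = min (H p) (H pt) - s'"
    have "e > 0" using s' by (simp add: e_def)
    obtain N A m where N: "prob_space N" "sets N = sets borel"
        "A \<in> sets N" "measure N A > 0" "AE x in N. x \<in> A \<longrightarrow> x \<in> level_set \<mu> \<alpha>"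
        "\<And>x n. x \<in> A \<Longrightarrow> m \<le> n \<Longrightarrow>
           measure N (cylinder (coord x) n) \<le> 2 powr (e * real n - (\<Sum>j=1..n. H (bias j)))"
      by (rule ex_level_measure[OF mean \<open>e > 0\<close>, unfolded H]) (rule that)
    show "hausdorff_measure s (level_set \<mu> \<alpha>) \<noteq> 0"
    proof (rule hausdorff_measure_nonzero[OF N(1-5)])
      show "s < s'" "0 < s'" using s' by auto
      show "measure N (cylinder (coord x) n) \<le> ((1/2) ^ n) powr s'" if "x \<in> A" "n \<ge> m" for x n
      proof -
        have "(\<Sum>j=1..n. min (H p) (H pt)) \<le> (\<Sum>j=1..n. H (bias j))"
          by (intro sum_mono) (use bias_cases in \<open>metis min.cobounded1 min.cobounded2\<close>)
        then have "e * real n - (\<Sum>j=1..n. H (bias j)) \<le> - (s' * real n)"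
          by (simp add: e_def algebra_simps)
        then show ?thesis unfolding half_power_powr
          by (intro order.trans[OF N(6)[OF that]] powr_mono) auto
      qed
    qed
  }
  { assume "s < max (H p) (H pt)"
    then obtain u where u: "u = p \<or> u = pt" "s < H u" by (auto simp: less_max_iff_disj)
    \<comment> \<open>Half the gap leaves s + e below \<open>H u\<close>, so the loss e n in the
      cylinder mass is absorbed along \<open>K\<close>.\<close>
    define e where "e = (H u - s) / 2"
    have "e > 0" using u by (simp add: e_def)
    obtain N A m where N: "prob_space N" "sets N = sets borel"
        "A \<in> sets N" "measure N A > 0" "AE x in N. x \<in> A \<longrightarrow> x \<in> level_set \<mu> \<alpha>"
        "\<And>x n. x \<in> A \<Longrightarrow> m \<le> n \<Longrightarrow>
           measure N (cylinder (coord x) n) \<le> 2 powr (e * real n - (\<Sum>j=1..n. H (bias j)))"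
      by (rule ex_level_measure[OF mean \<open>e > 0\<close>, unfolded H]) (rule that)
    define K where "K = {n. (s + e) * real n + (- s) \<le> (\<Sum>j=1..n. H (bias j))}"
    have "infinite K" unfolding K_def
      by (rule infinite_bias_sums[OF u(1)]) (use \<open>e > 0\<close> in \<open>simp add: e_def field_simps\<close>)
    then have K: "infinite (K - {..<m})" by simp
    have eq: "packing_measure s (level_set \<mu> \<alpha>) = mf_packing \<mu> 0 s (level_set \<mu> \<alpha>)"
      by (rule packing_measure_eq_mf_packing) (rule measure_ball_pos)
    show "packing_measure s (level_set \<mu> \<alpha>) \<noteq> 0"
      unfolding eq
    proof (rule mf_packing_nonzero[OF N(1-5) K])
      show "0 < measure \<mu> (cylinder \<epsilon> n)" for \<epsilon> n by (rule measure_cylinder_pos)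
      show "measure N (cylinder (coord x) n)
          \<le> (2 * (1/2) ^ n) powr s * measure \<mu> (cylinder (coord x) n) powr 0"
        if "x \<in> A" "n \<in> K - {..<m}" for x n
      proof -
        have "measure N (cylinder (coord x) n) \<le> 2 powr (e * real n - (\<Sum>j=1..n. H (bias j)))"
          using that by (intro N(6)) auto
        also have "\<dots> \<le> 2 powr (s - s * real n)"
          using that by (intro powr_mono) (auto simp: K_def algebra_simps)
        also have "\<dots> = (2 * (1/2) ^ n) powr s"
          unfolding powr_mult half_power_powr by (simp flip: powr_add)
        finally show ?thesis using measure_cylinder_pos[of "coord x" n] by simp
      qed
    qed
  }
qed

section \<open>The function B, its one-sided derivatives, and the dimensions\<close>

lemma mf_B_eq: "mf_B \<mu> UNIV q = ereal (max (theta p q) (theta pt q))"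
  unfolding mf_B_def
proof (rule antisym)
  show "Inf (ereal ` {s. mf_packing \<mu> q s UNIV = 0}) \<le> ereal (max (theta p q) (theta pt q))"
    by (rule Inf_ereal_image_le) (rule mf_packing_eq_0)
  show "ereal (max (theta p q) (theta pt q)) \<le> Inf (ereal ` {s. mf_packing \<mu> q s UNIV = 0})"
    by (rule Inf_ereal_image_ge) (use mf_packing_neq_0 in \<open>auto simp: less_max_iff_disj\<close>)
qed

text \<open>By \<open>theta_compare\<close> B follows the branch of \<open>pt\<close> on [0, 1] and
  that of \<open>p\<close> outside, so each one-sided derivative is the slope of the branch on that
  side.\<close>

lemma one_sided_derivs_B:
  shows "left_deriv (\<lambda>q. real_of_ereal (mf_B \<mu> UNIV q)) 0 = - gibbs_mean p 0"
    and "right_deriv (\<lambda>q. real_of_ereal (mf_B \<mu> UNIV q)) 0 = - gibbs_mean pt 0"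
    and "left_deriv (\<lambda>q. real_of_ereal (mf_B \<mu> UNIV q)) 1 = - gibbs_mean pt 1"
    and "right_deriv (\<lambda>q. real_of_ereal (mf_B \<mu> UNIV q)) 1 = - gibbs_mean p 1"
proof -
  have cmp: "q \<le> 0 \<or> 1 \<le> q \<Longrightarrow> theta pt q \<le> theta p q" "0 \<le> q \<Longrightarrow> q \<le> 1 \<Longrightarrow> theta p q \<le> theta pt q" for q
    using theta_compare[of p pt q] p by auto
  show "left_deriv (\<lambda>q. real_of_ereal (mf_B \<mu> UNIV q)) 0 = - gibbs_mean p 0"
    by (rule left_deriv_eqI[OF theta_has_derivative]) (use p cmp in \<open>auto simp: mf_B_eq\<close>)
  show "right_deriv (\<lambda>q. real_of_ereal (mf_B \<mu> UNIV q)) 0 = - gibbs_mean pt 0"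
    by (rule right_deriv_eqI[OF theta_has_derivative]) (use p cmp in \<open>auto simp: mf_B_eq\<close>)
  show "left_deriv (\<lambda>q. real_of_ereal (mf_B \<mu> UNIV q)) 1 = - gibbs_mean pt 1"
    by (rule left_deriv_eqI[OF theta_has_derivative]) (use p cmp in \<open>auto simp: mf_B_eq\<close>)
  show "right_deriv (\<lambda>q. real_of_ereal (mf_B \<mu> UNIV q)) 1 = - gibbs_mean p 1"
    by (rule right_deriv_eqI[OF theta_has_derivative]) (use p cmp in \<open>auto simp: mf_B_eq\<close>)
qed

lemma level_set_dims:
  assumes \<alpha>: "- log 2 (1 - pt) < \<alpha>" "\<alpha> < - log 2 pt"
  shows "hausdorff_dim (level_set \<mu> \<alpha>) = (INF q. mf_b \<mu> UNIV q + ereal (\<alpha> * q))"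
    and "\<alpha> \<notin> {gibbs_mean pt 0..gibbs_mean p 0} \<union> {gibbs_mean p 1..gibbs_mean pt 1} \<Longrightarrow>
      packing_dim (level_set \<mu> \<alpha>) = (INF q. mf_B \<mu> UNIV q + ereal (\<alpha> * q))"
proof -
  \<comment> \<open>A nonempty range of \<alpha> excludes pt = 1/2; moreover this range lies inside
    the corresponding one for \<open>p\<close>, so both equations for q are solvable.\<close>
  have "log 2 pt < log 2 (1 - pt)" using \<alpha> by linarith
  then have pt2: "pt < 1/2" using p by simp
  have "log 2 p < log 2 pt" "log 2 (1 - pt) < log 2 (1 - p)" using p by auto
  then have \<alpha>': "- log 2 (1 - p) < \<alpha>" "\<alpha> < - log 2 p" using \<alpha> by linarith+
  obtain qp where qp: "gibbs_mean p qp = \<alpha>" using ex_gibbs_mean_eq[OF _ _ _ \<alpha>'] p by auto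
  obtain qt where qt: "gibbs_mean pt qt = \<alpha>" using ex_gibbs_mean_eq[OF _ _ pt2 \<alpha>] p by auto
  define Q where "Q = (\<lambda>u. if u = p then qp else qt)"
  have Q: "Q p = qp" "Q pt = qt" using p by (auto simp: Q_def)
  have mean: "gibbs_mean p (Q p) = \<alpha>" "gibbs_mean pt (Q pt) = \<alpha>" using qp qt by (auto simp: Q)
  note lower = level_set_lower_bounds[OF mean, unfolded Q]
  define hp where "hp = theta p qp + \<alpha> * qp"
  define ht where "ht = theta pt qt + \<alpha> * qt"
  have pos: "0 < hp" "0 < ht"
    using theta_plus_mean_pos[of p qp] theta_plus_mean_pos[of pt qt] p qp qt
    by (simp_all add: hp_def ht_def)
  note lower = lower[folded hp_def ht_def]
  show "hausdorff_dim (level_set \<mu> \<alpha>) = (INF q. mf_b \<mu> UNIV q + ereal (\<alpha> * q))"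
  proof -
    \<comment> \<open>The q belonging to the smaller entropy makes the upper bound equal to the
      lower one.\<close>
    have ex: "\<exists>a q0. a + \<alpha> * q0 \<le> min hp ht \<and> (\<forall>s>a. mf_hausdorff \<mu> q0 s UNIV = 0)"
    proof (cases "hp \<le> ht")
      case True
      then have "theta p qp + \<alpha> * qp \<le> min hp ht" by (simp add: hp_def)
      then show ?thesis using mf_hausdorff_eq_0[of p qp] by blast
    next
      case False
      then have "theta pt qt + \<alpha> * qt \<le> min hp ht" by (simp add: ht_def)
      then show ?thesis using mf_hausdorff_eq_0[of pt qt] by blast
    qed
    then obtain a q0 where "a + \<alpha> * q0 \<le> min hp ht" "\<And>s. a < s \<Longrightarrow> mf_hausdorff \<mu> q0 s UNIV = 0" by blast
    then show ?thesis unfolding hausdorff_dim_def mf_b_def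
      by (intro critical_exponent_eq_INF[where h = "min hp ht" and a = a and ?q0.0 = q0])
         (use pos lower(1) hausdorff_measure_level_set_zero[OF measure_ball_pos] in auto)
  qed
  assume ni: "\<alpha> \<notin> {gibbs_mean pt 0..gibbs_mean p 0} \<union> {gibbs_mean p 1..gibbs_mean pt 1}"
  \<comment> \<open>Otherwise 0 < qp < 1 and qt is outside [0, 1]. Monotonicity of the means then
    puts \<alpha> in the first excluded interval if qt < 0 and in the second if qt > 1.\<close>
  have good: "qp \<le> 0 \<or> 1 \<le> qp \<or> (0 \<le> qt \<and> qt \<le> 1)"
  proof (rule ccontr)
    assume "\<not> ?thesis"
    then have q: "0 \<le> qp" "qp \<le> 1" "qt \<le> 0 \<or> 1 \<le> qt" by auto
    have "gibbs_mean p qp \<le> gibbs_mean p 0" "gibbs_mean p 1 \<le> gibbs_mean p qp"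
      using q p by (auto intro!: gibbs_mean_antimono)
    moreover have "qt \<le> 0 \<Longrightarrow> gibbs_mean pt 0 \<le> gibbs_mean pt qt"
        "1 \<le> qt \<Longrightarrow> gibbs_mean pt qt \<le> gibbs_mean pt 1"
      using p by (auto intro!: gibbs_mean_antimono)
    ultimately show False using ni q(3) unfolding qp qt by auto
  qed
  \<comment> \<open>At qp outside (0, 1) the branch of \<open>p\<close> is the larger and the bound
    is hp; otherwise qt lies in [0, 1], where the branch of \<open>pt\<close> is the larger, and the
    bound is ht.\<close>
  have "\<exists>a q0. a + \<alpha> * q0 \<le> max hp ht \<and> (\<forall>s>a. mf_packing \<mu> q0 s UNIV = 0)"
  proof (cases "qp \<le> 0 \<or> 1 \<le> qp")
    case True
    then have "max (theta p qp) (theta pt qp) = theta p qp" using theta_compare(1)[of p pt qp] p by auto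
    then have "\<forall>s>theta p qp. mf_packing \<mu> qp s UNIV = 0" using mf_packing_eq_0[of qp] by simp
    moreover have "theta p qp + \<alpha> * qp \<le> max hp ht" by (simp add: hp_def)
    ultimately show ?thesis by blast
  next
    case False
    then have "max (theta p qt) (theta pt qt) = theta pt qt"
      using good theta_compare(2)[of p pt qt] p by auto
    then have "\<forall>s>theta pt qt. mf_packing \<mu> qt s UNIV = 0" using mf_packing_eq_0[of qt] by simp
    moreover have "theta pt qt + \<alpha> * qt \<le> max hp ht" by (simp add: ht_def)
    ultimately show ?thesis by blast
  qed
  then obtain a q0 where "a + \<alpha> * q0 \<le> max hp ht" "\<And>s. a < s \<Longrightarrow> mf_packing \<mu> q0 s UNIV = 0" by blast
  then show "packing_dim (level_set \<mu> \<alpha>) = (INF q. mf_B \<mu> UNIV q + ereal (\<alpha> * q))"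
    unfolding packing_dim_def mf_B_def
    by (intro critical_exponent_eq_INF[where h = "max hp ht" and a = a and ?q0.0 = q0])
       (use pos lower(2) packing_measure_level_set_zero[OF measure_ball_pos] in auto)
qed

end

theorem proposition9:
  fixes p pt :: real
    and t :: "nat \<Rightarrow> nat"
    and \<omega> :: "nat \<Rightarrow> bool \<Rightarrow> real"
    and \<mu> :: "cantor measure"
    and b B :: "real \<Rightarrow> ereal"
    and Bl Br :: "real \<Rightarrow> real"
  assumes p: "0 < p" "p < pt" "pt \<le> 1/2"
    and t: "t 0 = 1" "strict_mono t"
    and t_lim: "(\<lambda>n. real (t n) / real (t (Suc n))) \<longlonglongrightarrow> 0"
    and \<omega>_odd: "\<And>j k e. k \<ge> 1 \<Longrightarrow> t (2 * k - 1) \<le> j \<Longrightarrow> j < t (2 * k) \<Longrightarrow>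
                   \<omega> j e = (if e then 1 - p else p)"
    and \<omega>_even: "\<And>j k e. t (2 * k) \<le> j \<Longrightarrow> j < t (2 * k + 1) \<Longrightarrow>
                   \<omega> j e = (if e then 1 - pt else pt)"
    and \<mu>: "sets \<mu> = sets borel" "prob_space \<mu>"
    and \<mu>_cyl: "\<And>\<epsilon> n. measure \<mu> (cylinder \<epsilon> n) = (\<Prod>j=1..n. \<omega> j (\<epsilon> j))"
  defines "b \<equiv> mf_b \<mu> (msupport \<mu>)"
    and "B \<equiv> mf_B \<mu> (msupport \<mu>)"
    and "Bl \<equiv> left_deriv (\<lambda>q. real_of_ereal (B q))"
    and "Br \<equiv> right_deriv (\<lambda>q. real_of_ereal (B q))"
  shows "(\<forall>\<alpha>\<in>{- log 2 (1 - pt) <..< - log 2 pt}.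
            hausdorff_dim (level_set \<mu> \<alpha>) = (INF q. b q + ereal (\<alpha> * q)))
       \<and> (\<forall>\<alpha>\<in>{- log 2 (1 - pt) <..< - log 2 pt} - ({- Br 0 .. - Bl 0} \<union> {- Br 1 .. - Bl 1}).
            packing_dim (level_set \<mu> \<alpha>) = (INF q. B q + ereal (\<alpha> * q)))"
proof -
  interpret alternating_coins p pt t \<omega> \<mu>
    by (rule alternating_coins.intro) (fact p t t_lim \<omega>_odd \<omega>_even \<mu>(2) \<mu>_cyl)+
  \<comment> \<open>The negated derivatives are the endpoints of the intervals excluded in
    \<open>level_set_dims\<close>.\<close>
  have "Bl 0 = - gibbs_mean p 0" "Br 0 = - gibbs_mean pt 0"
    "Bl 1 = - gibbs_mean pt 1" "Br 1 = - gibbs_mean p 1"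
    unfolding Bl_def Br_def B_def msupport_eq_UNIV by (fact one_sided_derivs_B)+
  then show ?thesis
    unfolding b_def B_def msupport_eq_UNIV using level_set_dims by auto
qed

end
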